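(* Let $0<\beta<1$, $H\in(1/2,1)$ and let $h\in\mathbb{W}$. If the measures $\mu_{\beta,2H}$ and $\mu_{\beta,2H}^h$ are equivalent (mutually absolutely continuous), then $h\in\mathcal{H}_H$.
   Context: $\mathbb{R}^+=[0,\infty)$. $\mathbb{W}$ is the space of continuous $w:\mathbb{R}^+\to\mathbb{R}$ with $w(0)=0$, with the topology of locally uniform convergence and Borel $\sigma$-algebra $\mathcal{B}(\mathbb{W})$. $\mathbb{P}_H$ is the unique probability measure on $\mathbb{W}$ under which the canonical process $W^H(t)(w)=w(t)$ is a fractional Brownian motion with Hurst index $H$, i.e. centered Gaussian with covariance $R_H(t,s)=\frac12(t^{2H}+s^{2H}-|t-s|^{2H})$. $\mathbb{P}_{Y_\beta}$ is the probability measure on $\mathbb{R}^+$ with density $M_\beta$ determined by $\int_0^\infty e^{-s\tau}M_\beta(\tau)\,d\tau=E_\beta(-s)$, $s\ge0$, with $E_\beta(z)=\sum_{n\ge0}z^n/\Gamma(\beta n+1)$. On $(\mathbb{W}\times\mathbb{R}^+,\mathcal{B}(\mathbb{W})\otimes\mathcal{B}(\mathbb{R}^+),\mathbb{P}_H\otimes\mathbb{P}_{Y_\beta})$ let $X_{\beta,2H}(t)(w,\tau)=w(t\tau^{1/(2H)})$ and, for $h\in\mathbb{W}$, $X_{\beta,2H}^h(t)(w,\tau)=w(t\tau^{1/(2H)})+h(t\tau^{1/(2H)})$, $t\ge0$. Their laws on $\mathbb{W}$ are $\mu_{\beta,2H}$ and $\mu_{\beta,2H}^h$. The Cameron--Martin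 space $\mathcal{H}_H$ is the completion of $\mathrm{span}\{R_H(t,\cdot):t\ge0\}$ for the scalar product determined by $(R_H(t,\cdot),R_H(s,\cdot))=R_H(t,s)$, realized as a space of functions on $\mathbb{R}^+$ (the reproducing kernel Hilbert space of $R_H$). *)

theory Defs
  imports "HOL-Probability.Probability" "HOL-Library.Poly_Mapping"
begin

section \<open>The path space\<close>

text \<open>
  Functions on \<open>[0,\<infinity>)\<close> are encoded as functions on \<^typ>\<open>real\<close> that vanish on the negative
  half-line, so that a path is determined by its values at nonnegative times.
\<close>

typedef wpath = "{w :: real \<Rightarrow> real. continuous_on {0..} w \<and> w 0 = 0 \<and> (\<forall>t<0. w t = 0)}"
  morphisms path_at Abs_wpath
proof
  show "(\<lambda>_. 0) \<in> {w :: real \<Rightarrow> real. continuous_on {0..} w \<and> w 0 = 0 \<and> (\<forall>t<0. w t = 0)}"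
    by simp
qed

setup_lifting type_definition_wpath

text \<open>
  The topology of locally uniform convergence: a neighbourhood base at \<open>w\<close> consists of the sets of
  paths that are uniformly \<open>e\<close>-close to \<open>w\<close> on \<open>[0,T]\<close>.
\<close>

instantiation wpath :: topological_space
begin

definition open_wpath :: "wpath set \<Rightarrow> bool" where
  "open_wpath U \<longleftrightarrow>
     (\<forall>w\<in>U. \<exists>T. \<exists>e>0. \<forall>v. (\<forall>t\<in>{0..T}. \<bar>path_at v t - path_at w t\<bar> < e) \<longrightarrow> v \<in> U)"

instance
proof
  show "open (UNIV :: wpath set)"
    by (auto simp: open_wpath_def intro: exI[of _ 1])
next
  fix U V :: "wpath set"
  assume U: "open U" and V: "open V"
  show "open (U \<inter> V)"
    unfolding open_wpath_def
  proof
    fix w assume w: "w \<in> U \<inter> V"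
    obtain T e where 1: "e > 0"
      "\<And>v. (\<forall>t\<in>{0..T}. \<bar>path_at v t - path_at w t\<bar> < e) \<Longrightarrow> v \<in> U"
      using U w unfolding open_wpath_def by blast
    obtain T' e' where 2: "e' > 0"
      "\<And>v. (\<forall>t\<in>{0..T'}. \<bar>path_at v t - path_at w t\<bar> < e') \<Longrightarrow> v \<in> V"
      using V w unfolding open_wpath_def by blast
    have "\<forall>v. (\<forall>t\<in>{0..max T T'}. \<bar>path_at v t - path_at w t\<bar> < min e e') \<longrightarrow> v \<in> U \<inter> V"
      by (intro allI impI IntI 1(2) 2(2)) auto
    moreover have "min e e' > 0" using 1(1) 2(1) by simp
    ultimately show "\<exists>T. \<exists>e>0. \<forall>v. (\<forall>t\<in>{0..T}. \<bar>path_at v t - path_at w t\<bar> < e) \<longrightarrow> v \<in> U \<inter> V"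
      by blast
  qed
next
  fix K :: "wpath set set"
  assume "\<forall>U\<in>K. open U"
  then show "open (\<Union>K)"
    unfolding open_wpath_def by (meson Union_iff)
qed

end


section \<open>Fractional Brownian motion\<close>

text \<open>Point masses count as (degenerate) Gaussian laws.\<close>

definition gaussian_law :: "real measure \<Rightarrow> bool" where
  "gaussian_law N \<longleftrightarrow>
     (\<exists>m \<sigma>. \<sigma> \<ge> 0 \<and> N = (if \<sigma> = 0 then return borel m else density lborel (normal_density m \<sigma>)))"

definition centered_gaussian_process ::
  "'a measure \<Rightarrow> 'i set \<Rightarrow> ('i \<Rightarrow> 'a \<Rightarrow> real) \<Rightarrow> ('i \<Rightarrow> 'i \<Rightarrow> real) \<Rightarrow> bool" where
  "centered_gaussian_process P I X K \<longleftrightarrow>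
     (\<forall>t\<in>I. X t \<in> borel_measurable P) \<and>
     (\<forall>F a. finite F \<and> F \<subseteq> I \<longrightarrow> gaussian_law (distr P borel (\<lambda>\<omega>. \<Sum>t\<in>F. a t * X t \<omega>))) \<and>
     (\<forall>t\<in>I. (\<integral>\<omega>. X t \<omega> \<partial>P) = 0) \<and>
     (\<forall>t\<in>I. \<forall>s\<in>I. (\<integral>\<omega>. X t \<omega> * X s \<omega> \<partial>P) = K t s)"

definition fbm_cov :: "real \<Rightarrow> real \<Rightarrow> real \<Rightarrow> real" where
  "fbm_cov H t s = (t powr (2 * H) + s powr (2 * H) - \<bar>t - s\<bar> powr (2 * H)) / 2"

definition is_fbm_law :: "real \<Rightarrow> wpath measure \<Rightarrow> bool" where
  "is_fbm_law H P \<longleftrightarrow>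
     prob_space P \<and> sets P = sets borel \<and>
     centered_gaussian_process P {0..} (\<lambda>t w. path_at w t) (fbm_cov H)"


section \<open>The random time scale\<close>

definition mittag_leffler :: "real \<Rightarrow> real \<Rightarrow> real" where
  "mittag_leffler \<beta> z = suminf (\<lambda>n. z ^ n / Gamma (\<beta> * real n + 1))"

definition is_M_density :: "real \<Rightarrow> (real \<Rightarrow> real) \<Rightarrow> bool" where
  "is_M_density \<beta> M \<longleftrightarrow>
     M \<in> borel_measurable (restrict_space borel {0..}) \<and>
     (\<forall>\<tau>\<ge>0. M \<tau> \<ge> 0) \<and>
     (\<forall>s\<ge>0. has_bochner_integral (restrict_space lborel {0..})
               (\<lambda>\<tau>. exp (- s * \<tau>) * M \<tau>) (mittag_leffler \<beta> (- s)))"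

definition Y_law :: "(real \<Rightarrow> real) \<Rightarrow> real measure" where
  "Y_law M = density (restrict_space lborel {0..}) M"


section \<open>Generalized grey Brownian motion and its shift\<close>

lemma continuous_on_time_scale:
  fixes w :: "real \<Rightarrow> real"
  assumes "continuous_on {0..} w" "c \<ge> 0"
  shows "continuous_on {0..} (\<lambda>t. w (t * c))"
  by (rule continuous_on_compose2[OF assms(1)]) (auto intro!: continuous_intros simp: assms(2))

lemma time_scale_neg:
  fixes w :: "real \<Rightarrow> real"
  assumes "w 0 = 0" "\<forall>t<0. w t = 0" "c \<ge> 0" "t < 0"
  shows "w (t * c) = 0"
proof (cases "c = 0")
  case False
  with assms(3,4) have "t * c < 0" by (simp add: mult_neg_pos)
  with assms(2) show ?thesis by blast
qed (simp add: assms(1))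

lift_definition ggbm_path :: "real \<Rightarrow> wpath \<Rightarrow> real \<Rightarrow> wpath" is
  "\<lambda>H w \<tau> t. w (t * \<tau> powr (1 / (2 * H)))"
  by (auto intro!: continuous_on_time_scale time_scale_neg)

lift_definition shifted_ggbm_path :: "real \<Rightarrow> wpath \<Rightarrow> wpath \<Rightarrow> real \<Rightarrow> wpath" is
  "\<lambda>H h w \<tau> t. w (t * \<tau> powr (1 / (2 * H))) + h (t * \<tau> powr (1 / (2 * H)))"
  by (auto intro!: continuous_on_add continuous_on_time_scale simp: time_scale_neg)

definition ggbm_law :: "real \<Rightarrow> wpath measure \<Rightarrow> real measure \<Rightarrow> wpath measure" where
  "ggbm_law H P Y = distr (P \<Otimes>\<^sub>M Y) borel (\<lambda>(w, \<tau>). ggbm_path H w \<tau>)"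

definition shifted_ggbm_law ::
  "real \<Rightarrow> wpath \<Rightarrow> wpath measure \<Rightarrow> real measure \<Rightarrow> wpath measure" where
  "shifted_ggbm_law H h P Y = distr (P \<Otimes>\<^sub>M Y) borel (\<lambda>(w, \<tau>). shifted_ggbm_path H h w \<tau>)"

definition equivalent_measures :: "'a measure \<Rightarrow> 'a measure \<Rightarrow> bool" where
  "equivalent_measures M N \<longleftrightarrow>
     sets M = sets N \<and> absolutely_continuous M N \<and> absolutely_continuous N M"


section \<open>The Cameron--Martin space\<close>

text \<open>
  A finitely supported \<open>c\<close> stands for the linear combination of the kernel functions \<open>K t\<close> with
  coefficients \<open>c\<^sub>t\<close>.
\<close>

definition kernel_comb :: "('i \<Rightarrow> 'i \<Rightarrow> real) \<Rightarrow> ('i \<Rightarrow>\<^sub>0 real) \<Rightarrow> 'i \<Rightarrow> real" where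
  "kernel_comb K c s = (\<Sum>t\<in>Poly_Mapping.keys c. Poly_Mapping.lookup c t * K t s)"

definition kernel_inner :: "('i \<Rightarrow> 'i \<Rightarrow> real) \<Rightarrow> ('i \<Rightarrow>\<^sub>0 real) \<Rightarrow> ('i \<Rightarrow>\<^sub>0 real) \<Rightarrow> real" where
  "kernel_inner K c d =
     (\<Sum>t\<in>Poly_Mapping.keys c. \<Sum>s\<in>Poly_Mapping.keys d. Poly_Mapping.lookup c t * Poly_Mapping.lookup d s * K t s)"

text \<open>
  The bilinear form depends on its arguments only through the functions they represent (for
  symmetric \<open>K\<close>, in both arguments), hence is a form on the span of the kernel functions.
\<close>

lemma kernel_inner_eq_sum_kernel_comb:
  "kernel_inner K c d = (\<Sum>s\<in>Poly_Mapping.keys d. Poly_Mapping.lookup d s * kernel_comb K c s)"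
  unfolding kernel_inner_def kernel_comb_def
  by (subst sum.swap) (simp add: sum_distrib_left mult_ac)

text \<open>
  The completion of the span, realized as a space of functions on \<open>I\<close>. Since
  \<open>\<bar>f s\<bar> \<le> sqrt (K s s) * \<parallel>f\<parallel>\<close> on the span, a Cauchy sequence for the kernel norm converges
  pointwise, and its class in the abstract completion is identified with the pointwise limit (which
  determines the class). Functions on \<open>I\<close> are extended by \<open>0\<close>, as for paths.
\<close>

definition rkhs :: "'i set \<Rightarrow> ('i \<Rightarrow> 'i \<Rightarrow> real) \<Rightarrow> ('i \<Rightarrow> real) set" where
  "rkhs I K = {f. (\<forall>s. s \<notin> I \<longrightarrow> f s = 0) \<and>
     (\<exists>c :: nat \<Rightarrow> 'i \<Rightarrow>\<^sub>0 real.
        (\<forall>n. Poly_Mapping.keys (c n) \<subseteq> I) \<and>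
        (\<forall>e>0. \<exists>N. \<forall>m\<ge>N. \<forall>n\<ge>N. sqrt (kernel_inner K (c m - c n) (c m - c n)) < e) \<and>
        (\<forall>s\<in>I. (\<lambda>n. kernel_comb K (c n) s) \<longlonglongrightarrow> f s))}"

definition cameron_martin :: "real \<Rightarrow> (real \<Rightarrow> real) set" where
  "cameron_martin H = rkhs {0..} (fbm_cov H)"

end

theory Submission imports Defs begin

text \<open>
  The idea is to read the random time scale off a path, to undo it, and then to use that outside
  the Cameron--Martin space shifts of a Gaussian measure can be detected by linear functionals.

  \<^bold>\<open>Estimating the time scale.\<close> In logarithmic time \<open>u = ln t\<close> the process \<open>exp (- H * u) * w (exp u)\<close> is
  stationary and its correlations decay exponentially. Averages of its square over longer and longer
  stretches of logarithmic time (\<open>log_energy\<close>) therefore tend to 1. Replacing \<open>w\<close> by \<open>w (c * _)\<close> with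
  \<open>c = \<tau> powr (1 / (2 * H))\<close> translates logarithmic time, which such averages do not notice in the
  limit, and multiplies the square by \<open>c powr (2 * H) = \<tau>\<close>. So the averages along the unshifted path
  tend to \<open>\<tau>\<close> (\<open>log_energy_dilation_limit\<close>).

  \<^bold>\<open>Effect of the shift.\<close> By compactness the averages for \<open>h\<close> itself converge along a sequence of
  stretches to some \<open>a \<in> [0,\<infinity>]\<close>. Nothing makes \<open>a\<close> vanish: \<open>h\<close> may look like a path of the process. But
  \<open>a\<close> is a constant, unaffected by dilations, and the mixed terms average out
  (\<open>AE_shifted_energy_limit\<close>). So the averages along the shifted path tend to \<open>\<tau> * (1 + a)\<close>. If
  \<open>a = \<infinity>\<close>, this already distinguishes the two laws.

  \<^bold>\<open>Undoing the time scale.\<close> If \<open>a < \<infinity>\<close>, the limit divided by \<open>1 + a\<close> is \<open>\<tau>\<close> for the shifted path and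
  \<open>\<tau> / (1 + a)\<close> for the unshifted one. Rescaling time accordingly turns the shifted path into \<open>w + h\<close>
  and the unshifted one into \<open>w (b * _)\<close> with a constant \<open>b\<close>, so that \<open>\<tau>\<close> has disappeared.

  \<^bold>\<open>Detecting the shift.\<close> If \<open>h\<close> is not in the Cameron--Martin space, the functional it defines on the
  span of the kernel functions is unbounded (\<open>in_rkhs_if_bounded_functional\<close>). This gives
  combinations of evaluations that take the value 1 at \<open>h\<close> and have summable second moments under
  fractional Brownian motion. At the rescaled shifted path they tend to 1, at the rescaled unshifted
  path to 0, almost surely in both cases. Thus some event has measure 1 for one law and 0 for the
  other, and the laws are not equivalent (\<open>no_separating_event\<close>).
\<close>

section \<open>Measurability on the path space\<close>

lemma path_at_nonpos: "t \<le> 0 \<Longrightarrow> path_at w t = 0"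
  using path_at[of w] by (cases "t = 0") auto

lemma continuous_path_at: "continuous_on UNIV (path_at w)"
proof -
  have "continuous_on {..0} (path_at w)"
    by (rule continuous_on_eq[of _ "\<lambda>_. 0"]) (auto simp: path_at_nonpos)
  moreover have "continuous_on {0..} (path_at w)"
    using path_at[of w] by auto
  ultimately have "continuous_on ({..0} \<union> {0..}) (path_at w)"
    by (intro continuous_on_closed_Un) auto
  moreover have "{..0} \<union> {0..} = (UNIV :: real set)" by auto
  ultimately show ?thesis by simp
qed

lemma measurable_path_at [measurable]: "(\<lambda>w. path_at w t) \<in> borel_measurable borel"
proof (rule borel_measurableI)
  fix S :: "real set" assume S: "open S"
  have "open ((\<lambda>w. path_at w t) -` S)"
    unfolding open_wpath_def
  proof
    fix w assume "w \<in> (\<lambda>w. path_at w t) -` S"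
    then obtain e where e: "e > 0" "\<And>y. dist y (path_at w t) < e \<Longrightarrow> y \<in> S"
      using S unfolding open_dist by auto
    show "\<exists>T. \<exists>e>0. \<forall>v. (\<forall>t\<in>{0..T}. \<bar>path_at v t - path_at w t\<bar> < e) \<longrightarrow> v \<in> (\<lambda>w. path_at w t) -` S"
    proof (rule exI[of _ t], rule exI[of _ e], intro conjI allI impI)
      fix v assume v: "\<forall>s\<in>{0..t}. \<bar>path_at v s - path_at w s\<bar> < e"
      have "\<bar>path_at v t - path_at w t\<bar> < e"
        using v e(1) by (cases "t \<ge> 0") (auto simp: path_at_nonpos)
      then show "v \<in> (\<lambda>w. path_at w t) -` S"
        using e(2) by (simp add: dist_real_def)
    qed (rule e)
  qed
  then show "(\<lambda>w. path_at w t) -` S \<inter> space borel \<in> sets borel" by auto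
qed

text \<open>
  A path is continuous in time and measurable in the path variable, so the approximations that
  round the time down to a multiple of \<open>1 / (n + 1)\<close> are measurable and converge pointwise.
\<close>

lemma measurable_path_at_pair [measurable]:
  "(\<lambda>(w, t). path_at w t) \<in> borel_measurable (borel \<Otimes>\<^sub>M borel)"
proof -
  have "(\<lambda>p. path_at (fst p) (of_int \<lfloor>real (Suc n) * snd p\<rfloor> / real (Suc n)))
      \<in> borel_measurable (borel \<Otimes>\<^sub>M borel)" for n
    by (rule measurable_compose_countable[where f="\<lambda>i p. path_at (fst p) (of_int i / real (Suc n))"
          and g="\<lambda>p. \<lfloor>real (Suc n) * snd p\<rfloor>"]) measurable
  moreover have "(\<lambda>n. path_at w (of_int \<lfloor>real (Suc n) * t\<rfloor> / real (Suc n))) \<longlonglongrightarrow> path_at w t" for w t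
  proof -
    have "(\<lambda>n. of_int \<lfloor>real (Suc n) * t\<rfloor> / real (Suc n)) \<longlonglongrightarrow> t"
    proof (rule real_tendsto_sandwich)
      show "\<forall>\<^sub>F n in sequentially. t - 1 / real (Suc n) \<le> of_int \<lfloor>real (Suc n) * t\<rfloor> / real (Suc n)"
      proof (rule always_eventually, rule allI)
        fix n
        have "real (Suc n) * t - 1 \<le> of_int \<lfloor>real (Suc n) * t\<rfloor>" by linarith
        then have "(real (Suc n) * t - 1) / real (Suc n) \<le> of_int \<lfloor>real (Suc n) * t\<rfloor> / real (Suc n)"
          by (rule divide_right_mono) simp
        then show "t - 1 / real (Suc n) \<le> of_int \<lfloor>real (Suc n) * t\<rfloor> / real (Suc n)"
          by (simp add: diff_divide_distrib)
      qed
      show "\<forall>\<^sub>F n in sequentially. of_int \<lfloor>real (Suc n) * t\<rfloor> / real (Suc n) \<le> t"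
      proof (rule always_eventually, rule allI)
        fix n
        have "of_int \<lfloor>real (Suc n) * t\<rfloor> / real (Suc n) \<le> (real (Suc n) * t) / real (Suc n)"
          by (rule divide_right_mono) auto
        then show "of_int \<lfloor>real (Suc n) * t\<rfloor> / real (Suc n) \<le> t" by simp
      qed
      show "(\<lambda>n. t - 1 / real (Suc n)) \<longlonglongrightarrow> t"
        using tendsto_diff[OF tendsto_const LIMSEQ_inverse_real_of_nat, of t]
        by (simp add: inverse_eq_divide)
    qed simp
    then show ?thesis
      using continuous_path_at[of w] by (intro continuous_on_tendsto_compose[OF continuous_path_at]) auto
  qed
  ultimately have "(\<lambda>p. path_at (fst p) (snd p)) \<in> borel_measurable (borel \<Otimes>\<^sub>M borel)"
    by (rule borel_measurable_LIMSEQ_real[rotated])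
  then show ?thesis by (simp add: case_prod_beta)
qed

text \<open>
  The family of these sets is countable, each of them is cut out by countably many evaluations, and
  every open set is a union of some of them. It replaces a countable base of the topology: a tube
  need not be open, but it contains the given path and is thin on a given compact time interval.
\<close>

definition tube :: "nat \<Rightarrow> nat \<Rightarrow> rat list \<Rightarrow> wpath set" where
  "tube k m q = {v. \<forall>i<length q. \<forall>r::rat.
      of_rat r \<in> {real i / real (Suc m)..real (Suc i) / real (Suc m)} \<longrightarrow>
      \<bar>path_at v (of_rat r) - of_rat (q ! i)\<bar> \<le> 1 / real (Suc k)}"

text \<open>
  A tube controls only rational times; continuity extends the bound to all times before the end of
  the last step.
\<close>

lemma tube_diameter:
  assumes v: "v \<in> tube k m q" and w: "w \<in> tube k m q"
    and t: "0 \<le> t" "t < real (length q) / real (Suc m)"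
  shows "\<bar>path_at v t - path_at w t\<bar> \<le> 2 / real (Suc k)"
proof -
  define i where "i = nat \<lfloor>t * real (Suc m)\<rfloor>"
  have i1: "real i \<le> t * real (Suc m)" "t * real (Suc m) < real (Suc i)"
    unfolding i_def using t(1) by (simp_all, linarith+)
  have "t * real (Suc m) < real (length q)"
    using t(2) by (simp add: pos_less_divide_eq)
  with i1(1) have "real i < real (length q)" by linarith
  then have il: "i < length q" by simp
  have i2: "real i / real (Suc m) \<le> t" "t < real (Suc i) / real (Suc m)"
    using i1 by (simp_all only: pos_divide_le_eq pos_less_divide_eq of_nat_0_less_iff zero_less_Suc)
  let ?D = "{t<..<real (Suc i) / real (Suc m)} \<inter> range of_rat"
  let ?f = "\<lambda>t. \<bar>path_at v t - path_at w t\<bar>"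
  have cont: "continuous_on UNIV ?f"
    by (intro continuous_intros continuous_path_at)
  have "t \<in> closure ?D"
  proof (subst closure_approachable, intro allI impI)
    fix e :: real assume "e > 0"
    then have "t < min (t + e) (real (Suc i) / real (Suc m))" using i2 by simp
    then obtain r where r: "t < of_rat r" "of_rat r < min (t + e) (real (Suc i) / real (Suc m))"
      using of_rat_dense by blast
    then show "\<exists>y\<in>?D. dist y t < e"
      by (intro bexI[of _ "of_rat r"]) (auto simp: dist_real_def)
  qed
  moreover have "?f ` closure ?D \<subseteq> closure (?f ` ?D)"
    by (rule image_closure_subset[OF continuous_on_subset[OF cont]]) (auto simp: closure_subset)
  moreover have "closure (?f ` ?D) \<subseteq> {..2 / real (Suc k)}"
  proof (rule closure_minimal)
    show "?f ` ?D \<subseteq> {..2 / real (Suc k)}"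
    proof clarsimp
      fix r :: rat assume "t < of_rat r" "of_rat r < (1 + real i) / (1 + real m)"
      then have r: "of_rat r \<in> {real i / real (Suc m)..real (Suc i) / real (Suc m)}"
        using i2 by auto
      have "\<bar>path_at v (of_rat r) - of_rat (q ! i)\<bar> \<le> 1 / real (Suc k)"
        using v il r unfolding tube_def by blast
      moreover have "\<bar>path_at w (of_rat r) - of_rat (q ! i)\<bar> \<le> 1 / real (Suc k)"
        using w il r unfolding tube_def by blast
      moreover have "2 / real (Suc k) = 1 / real (Suc k) + 1 / real (Suc k)" by simp
      ultimately have "\<bar>path_at v (of_rat r) - path_at w (of_rat r)\<bar> \<le> 2 / real (Suc k)" by linarith
      then show "\<bar>path_at v (of_rat r) - path_at w (of_rat r)\<bar> \<le> 2 / (1 + real k)" by simp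
    qed
  qed simp
  ultimately show ?thesis by blast
qed

text \<open>
  Uniform continuity on a slightly longer interval provides the step length.
\<close>

lemma tube_exists:
  fixes w :: wpath
  shows "\<exists>m q. w \<in> tube k m q \<and> T < real (length q) / real (Suc m)"
proof -
  define B where "B = max T 0 + 2"
  define d where "d = 1 / real (Suc k)"
  have d: "d > 0" by (simp add: d_def)
  have "uniformly_continuous_on {0..B} (path_at w)"
    by (rule compact_uniformly_continuous[OF continuous_on_subset[OF continuous_path_at]]) auto
  then obtain \<delta> where \<delta>: "\<delta> > 0"
    "\<And>t s. t \<in> {0..B} \<Longrightarrow> s \<in> {0..B} \<Longrightarrow> dist s t < \<delta> \<Longrightarrow> dist (path_at w s) (path_at w t) < d / 2"
    unfolding uniformly_continuous_on_def using d by (metis half_gt_zero)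
  obtain m :: nat where m: "1 / real (Suc m) < \<delta>"
    using reals_Archimedean[OF \<delta>(1)] by (auto simp: inverse_eq_divide)
  have m1: "1 / real (Suc m) \<le> 1" by simp
  define N where "N = nat \<lfloor>(max T 0 + 1) * real (Suc m)\<rfloor>"
  have "(max T 0 + 1) * real (Suc m) \<ge> 0" by (intro mult_nonneg_nonneg) auto
  then have N1: "real N \<le> (max T 0 + 1) * real (Suc m)" "(max T 0 + 1) * real (Suc m) < real N + 1"
    unfolding N_def by linarith+
  have "real N / real (Suc m) \<le> max T 0 + 1"
    using N1(1) by (simp only: pos_divide_le_eq of_nat_0_less_iff zero_less_Suc)
  have NT: "T < real N / real (Suc m)"
  proof -
    have "real (Suc m) \<ge> 1" by simp
    then have "T * real (Suc m) \<le> max T 0 * real (Suc m)" by (intro mult_right_mono) auto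
    also have "\<dots> < real N" using N1(2) \<open>real (Suc m) \<ge> 1\<close> by (simp add: algebra_simps)
    finally show ?thesis by (simp only: pos_less_divide_eq of_nat_0_less_iff zero_less_Suc)
  qed
  have "\<exists>a::rat. \<bar>path_at w (real i / real (Suc m)) - of_rat a\<bar> < d / 2" for i
  proof -
    have "path_at w (real i / real (Suc m)) < path_at w (real i / real (Suc m)) + d / 2"
      using d by simp
    then obtain a where "path_at w (real i / real (Suc m)) < of_rat a"
      "of_rat a < path_at w (real i / real (Suc m)) + d / 2" using of_rat_dense by blast
    then show ?thesis by (intro exI[of _ a]) auto
  qed
  then obtain a :: "nat \<Rightarrow> rat" where a: "\<And>i. \<bar>path_at w (real i / real (Suc m)) - of_rat (a i)\<bar> < d / 2"
    by metis
  have "w \<in> tube k m (map a [0..<N])"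
    unfolding tube_def
  proof (intro CollectI allI impI)
    fix i r assume i: "i < length (map a [0..<N])"
      and r: "of_rat r \<in> {real i / real (Suc m)..real (Suc i) / real (Suc m)}"
    have "real (Suc i) / real (Suc m) \<le> real N / real (Suc m)"
      using i by (intro divide_right_mono) auto
    with \<open>real N / real (Suc m) \<le> max T 0 + 1\<close> have B: "real (Suc i) / real (Suc m) \<le> B"
      by (simp add: B_def)
    have step: "real (Suc i) / real (Suc m) = real i / real (Suc m) + 1 / real (Suc m)"
      by (simp add: add_divide_distrib)
    have "dist (path_at w (of_rat r)) (path_at w (real i / real (Suc m))) < d / 2"
    proof (rule \<delta>(2))
      show "real i / real (Suc m) \<in> {0..B}" using B step by (auto intro: order_trans[rotated])
      have "0 \<le> real i / real (Suc m)" by simp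
      then have "0 \<le> (of_rat r :: real)" using r by (meson atLeastAtMost_iff order_trans)
      then show "of_rat r \<in> {0..B}" using r B by (meson atLeastAtMost_iff order_trans)
      show "dist (of_rat r) (real i / real (Suc m)) < \<delta>"
        using r step m by (auto simp: dist_real_def)
    qed
    then have "\<bar>path_at w (of_rat r) - of_rat (a i)\<bar> \<le> d"
      using a[of i] unfolding dist_real_def by linarith
    with i show "\<bar>path_at w (of_rat r) - of_rat (map a [0..<N] ! i)\<bar> \<le> 1 / real (Suc k)"
      by (simp add: d_def)
  qed
  with NT show ?thesis by (intro exI[of _ m] exI[of _ "map a [0..<N]"]) simp
qed

text \<open>
  In other words, evaluations generate the Borel sets of the path space. The laws of the two
  processes are image measures under maps into this space, and are only meaningful because these
  maps are measurable.
\<close>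

lemma measurable_into_wpath:
  fixes f :: "'a \<Rightarrow> wpath"
  assumes ev [measurable]: "\<And>t. (\<lambda>\<omega>. path_at (f \<omega>) t) \<in> borel_measurable M"
  shows "f \<in> borel_measurable M"
proof (rule borel_measurableI)
  fix U :: "wpath set" assume U: "open U"
  let ?I = "{(k, m, q). tube k m q \<subseteq> U}"
  have "U = (\<Union>(k, m, q)\<in>?I. tube k m q)"
  proof
    show "U \<subseteq> (\<Union>(k, m, q)\<in>?I. tube k m q)"
    proof
      fix w assume "w \<in> U"
      then obtain T e where e: "e > 0"
        "\<And>v. (\<forall>t\<in>{0..T}. \<bar>path_at v t - path_at w t\<bar> < e) \<Longrightarrow> v \<in> U"
        using U unfolding open_wpath_def by blast
      obtain k where "inverse (real (Suc k)) < e / 2"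
        using reals_Archimedean[of "e / 2"] e(1) by auto
      then have k: "2 / real (Suc k) < e"
        by (simp add: field_simps)
      obtain m q where mq: "w \<in> tube k m q" "T < real (length q) / real (Suc m)"
        using tube_exists by blast
      have "tube k m q \<subseteq> U"
      proof
        fix v assume v: "v \<in> tube k m q"
        show "v \<in> U"
        proof (rule e(2), rule ballI)
          fix t assume "t \<in> {0..T}"
          then have "\<bar>path_at v t - path_at w t\<bar> \<le> 2 / real (Suc k)"
            using mq(2) by (intro tube_diameter[OF v mq(1)]) auto
          then show "\<bar>path_at v t - path_at w t\<bar> < e" using k by linarith
        qed
      qed
      with mq(1) show "w \<in> (\<Union>(k, m, q)\<in>?I. tube k m q)" by blast
    qed
  qed auto
  then have "f -` U \<inter> space M = f -` (\<Union>(k, m, q)\<in>?I. tube k m q) \<inter> space M" by (rule arg_cong)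
  also have "\<dots> = (\<Union>(k, m, q)\<in>?I. f -` tube k m q \<inter> space M)" by auto
  also have "\<dots> \<in> sets M"
  proof -
    have "f -` tube k m q \<inter> space M \<in> sets M" for k m q
    proof -
      have "{\<omega> \<in> space M. \<forall>i<length q. \<forall>r::rat.
        of_rat r \<in> {real i / real (Suc m)..real (Suc i) / real (Suc m)} \<longrightarrow>
        \<bar>path_at (f \<omega>) (of_rat r) - of_rat (q ! i)\<bar> \<le> 1 / real (Suc k)} \<in> sets M"
        by measurable
      moreover have "f -` tube k m q \<inter> space M = {\<omega> \<in> space M. \<forall>i<length q. \<forall>r::rat.
        of_rat r \<in> {real i / real (Suc m)..real (Suc i) / real (Suc m)} \<longrightarrow>
        \<bar>path_at (f \<omega>) (of_rat r) - of_rat (q ! i)\<bar> \<le> 1 / real (Suc k)}"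
        unfolding tube_def by blast
      ultimately show ?thesis by simp
    qed
    then show ?thesis by (intro sets.countable_UN'') auto
  qed
  finally show "f -` U \<inter> space M \<in> sets M" .
qed

section \<open>Gaussian moments\<close>

lemma integrable_mult_of_squares:
  fixes X Y :: "'a \<Rightarrow> real"
  assumes [measurable]: "X \<in> borel_measurable M" "Y \<in> borel_measurable M"
    and int: "integrable M (\<lambda>\<omega>. X \<omega> * X \<omega>)" "integrable M (\<lambda>\<omega>. Y \<omega> * Y \<omega>)"
  shows "integrable M (\<lambda>\<omega>. X \<omega> * Y \<omega>)"
proof (rule Bochner_Integration.integrable_bound[OF Bochner_Integration.integrable_add[OF int]])
  have "norm (X \<omega> * Y \<omega>) \<le> norm (X \<omega> * X \<omega> + Y \<omega> * Y \<omega>)" for \<omega>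
  proof -
    have "2 * (\<bar>X \<omega>\<bar> * \<bar>Y \<omega>\<bar>) \<le> X \<omega> * X \<omega> + Y \<omega> * Y \<omega>"
      using sum_squares_bound[of "\<bar>X \<omega>\<bar>" "\<bar>Y \<omega>\<bar>"] by (simp add: power2_eq_square)
    moreover have "0 \<le> \<bar>X \<omega>\<bar> * \<bar>Y \<omega>\<bar>" by simp
    ultimately show ?thesis unfolding real_norm_def abs_mult by linarith
  qed
  then show "AE \<omega> in M. norm (X \<omega> * Y \<omega>) \<le> norm (X \<omega> * X \<omega> + Y \<omega> * Y \<omega>)" by simp
qed measurable

lemma (in prob_space) centered_gaussian_moments:
  assumes X [measurable]: "X \<in> borel_measurable M"
    and g: "gaussian_law (distr M borel X)" and mean: "expectation X = 0"
  shows "integrable M (\<lambda>\<omega>. X \<omega> ^ k)"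
    and "expectation (\<lambda>\<omega>. X \<omega> ^ 3) = 0"
    and "expectation (\<lambda>\<omega>. X \<omega> ^ 4) = 3 * (expectation (\<lambda>\<omega>. X \<omega> ^ 2))\<^sup>2"
proof -
  obtain m \<sigma> where \<sigma>: "\<sigma> \<ge> 0"
    and D: "distr M borel X = (if \<sigma> = 0 then return borel m else density lborel (normal_density m \<sigma>))"
    using g unfolding gaussian_law_def by blast
  have I: "expectation (\<lambda>\<omega>. X \<omega> ^ k) = (\<integral>x. x ^ k \<partial>distr M borel X)" for k
    by (rule integral_distr[symmetric]) measurable
  have J: "integrable M (\<lambda>\<omega>. X \<omega> ^ k) \<longleftrightarrow> integrable (distr M borel X) (\<lambda>x. x ^ k)" for k
    by (rule integrable_distr_eq[symmetric]) measurable
  have "integrable M (\<lambda>\<omega>. X \<omega> ^ k) \<and> expectation (\<lambda>\<omega>. X \<omega> ^ 3) = 0 \<and>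
    expectation (\<lambda>\<omega>. X \<omega> ^ 4) = 3 * (expectation (\<lambda>\<omega>. X \<omega> ^ 2))\<^sup>2"
  proof (cases "\<sigma> = 0")
    case True
    then have D': "distr M borel X = return borel m" using D by simp
    have "m = 0" using mean I[of 1] by (simp add: D' integral_return)
    have "integrable (return borel m) (\<lambda>x. x ^ k)"
      by (rule integrableI_bounded) (auto simp: nn_integral_return)
    then show ?thesis
      unfolding I J D' using \<open>m = 0\<close> by (simp add: integral_return)
  next
    case False
    then have \<sigma>: "\<sigma> > 0" and D': "distr M borel X = density lborel (normal_density m \<sigma>)"
      using \<sigma> D by auto
    have I': "expectation (\<lambda>\<omega>. X \<omega> ^ k) = (\<integral>x. normal_density m \<sigma> x * x ^ k \<partial>lborel)" for k
      unfolding I D' by (subst integral_density) (auto simp: normal_density_nonneg)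
    have "m = 0" using mean I'[of 1] integral_normal_moment_nz_1[OF \<sigma>] by simp
    note [simp] = \<open>m = 0\<close>
    have "integrable M (\<lambda>\<omega>. X \<omega> ^ k)"
      unfolding J D' using integrable_normal_moment[OF \<sigma>, of 0 k]
      by (subst integrable_density) (auto simp: normal_density_nonneg)
    moreover have "expectation (\<lambda>\<omega>. X \<omega> ^ 3) = 0"
      using integral_normal_moment_odd[OF \<sigma>, of 0 1] unfolding I' by (simp add: numeral_3_eq_3)
    moreover have "expectation (\<lambda>\<omega>. X \<omega> ^ 2) = \<sigma>\<^sup>2"
      using integral_normal_moment_even[OF \<sigma>, of 0 1] unfolding I' by (simp add: fact_numeral)
    moreover have "expectation (\<lambda>\<omega>. X \<omega> ^ 4) = 3 * \<sigma> ^ 4"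
      using integral_normal_moment_even[OF \<sigma>, of 0 2] unfolding I'
      by (simp add: fact_numeral power2_eq_square power4_eq_xxxx field_simps)
    ultimately show ?thesis by (simp add: power_mult[symmetric])
  qed
  then show "integrable M (\<lambda>\<omega>. X \<omega> ^ k)" "expectation (\<lambda>\<omega>. X \<omega> ^ 3) = 0"
    "expectation (\<lambda>\<omega>. X \<omega> ^ 4) = 3 * (expectation (\<lambda>\<omega>. X \<omega> ^ 2))\<^sup>2" by auto
qed

lemma (in prob_space) shifted_gaussian_fourth_moment:
  assumes X [measurable]: "X \<in> borel_measurable M"
    and g: "gaussian_law (distr M borel X)" and mean: "expectation X = 0"
    and v: "expectation (\<lambda>\<omega>. X \<omega> ^ 2) = v"
  shows "has_bochner_integral M (\<lambda>\<omega>. (X \<omega> + a) ^ 4) (a ^ 4 + 6 * a\<^sup>2 * v + 3 * v\<^sup>2)"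
proof -
  note int = centered_gaussian_moments(1)[OF X g mean]
  have i: "integrable M X" using int[of 1] by simp
  have "has_bochner_integral M (\<lambda>\<omega>. X \<omega> ^ 4 + (4 * a) * X \<omega> ^ 3 + (6 * a\<^sup>2) * X \<omega> ^ 2 + (4 * a ^ 3) * X \<omega> + a ^ 4)
      (3 * v\<^sup>2 + (4 * a) * 0 + (6 * a\<^sup>2) * v + (4 * a ^ 3) * 0 + a ^ 4)"
    using has_bochner_integral_integrable[OF int[of 4]] has_bochner_integral_integrable[OF int[of 3]]
      has_bochner_integral_integrable[OF int[of 2]] has_bochner_integral_integrable[OF i]
    unfolding centered_gaussian_moments(2,3)[OF X g mean] v mean
    by (intro has_bochner_integral_add has_bochner_integral_mult_right)
      (auto simp: has_bochner_integral_iff prob_space)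
  moreover have "(\<lambda>\<omega>. X \<omega> ^ 4 + (4 * a) * X \<omega> ^ 3 + (6 * a\<^sup>2) * X \<omega> ^ 2 + (4 * a ^ 3) * X \<omega> + a ^ 4)
     = (\<lambda>\<omega>. (X \<omega> + a) ^ 4)"
    by (rule ext) algebra
  ultimately show ?thesis by (simp add: add_ac)
qed

text \<open>
  Wick's formula for two shifted squares. It follows from the fourth moment of a single Gaussian
  variable through the polarization identity
  \<open>12 * u\<^sup>2 * w\<^sup>2 = (u + w)^4 + (u - w)^4 - 2 * u^4 - 2 * w^4\<close>.
\<close>

lemma (in prob_space) gaussian_pair_moment:
  assumes X [measurable]: "X \<in> borel_measurable M" and Y [measurable]: "Y \<in> borel_measurable M"
    and g: "\<And>c d. gaussian_law (distr M borel (\<lambda>\<omega>. c * X \<omega> + d * Y \<omega>))"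
    and mean: "expectation X = 0" "expectation Y = 0"
    and var: "expectation (\<lambda>\<omega>. X \<omega> * X \<omega>) = p" "expectation (\<lambda>\<omega>. Y \<omega> * Y \<omega>) = q"
    and cov: "expectation (\<lambda>\<omega>. X \<omega> * Y \<omega>) = r"
  shows "has_bochner_integral M (\<lambda>\<omega>. (X \<omega> + a)\<^sup>2 * (Y \<omega> + b)\<^sup>2)
           ((p + a\<^sup>2) * (q + b\<^sup>2) + 2 * r\<^sup>2 + 4 * r * a * b)"
proof -
  have gX: "gaussian_law (distr M borel X)" using g[of 1 0] by simp
  have gY: "gaussian_law (distr M borel Y)" using g[of 0 1] by simp
  note mX = centered_gaussian_moments(1)[OF X gX mean(1)]
  note mY = centered_gaussian_moments(1)[OF Y gY mean(2)]
  have iX: "integrable M X" and iY: "integrable M Y" using mX[of 1] mY[of 1] by auto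
  have iXX: "integrable M (\<lambda>\<omega>. X \<omega> * X \<omega>)" and iYY: "integrable M (\<lambda>\<omega>. Y \<omega> * Y \<omega>)"
    using mX[of 2] mY[of 2] by (auto simp: power2_eq_square)
  have iXY: "integrable M (\<lambda>\<omega>. X \<omega> * Y \<omega>)"
    by (rule integrable_mult_of_squares[OF X Y iXX iYY])
  define f where "f c d \<omega> = ((c * X \<omega> + d * Y \<omega>) + (c * a + d * b)) ^ 4" for c d \<omega>
  define e where "e c d = (c * a + d * b) ^ 4 + 6 * (c * a + d * b)\<^sup>2 * (c * c * p + 2 * c * d * r + d * d * q)
      + 3 * (c * c * p + 2 * c * d * r + d * d * q)\<^sup>2" for c d
  have key: "has_bochner_integral M (f c d) (e c d)" for c d
    unfolding f_def e_def
  proof (rule shifted_gaussian_fourth_moment)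
    have "(\<lambda>\<omega>. (c * X \<omega> + d * Y \<omega>) ^ 2)
      = (\<lambda>\<omega>. (c * c) * (X \<omega> * X \<omega>) + (2 * c * d) * (X \<omega> * Y \<omega>) + (d * d) * (Y \<omega> * Y \<omega>))"
      by (rule ext) algebra
    then show "expectation (\<lambda>\<omega>. (c * X \<omega> + d * Y \<omega>) ^ 2) = c * c * p + 2 * c * d * r + d * d * q"
      using iXX iXY iYY by (simp add: var cov)
    show "expectation (\<lambda>\<omega>. c * X \<omega> + d * Y \<omega>) = 0" using iX iY by (simp add: mean)
    show "(\<lambda>\<omega>. c * X \<omega> + d * Y \<omega>) \<in> borel_measurable M" by measurable
  qed (rule g)
  have "has_bochner_integral M (\<lambda>\<omega>. (f 1 1 \<omega> + f 1 (- 1) \<omega> - 2 * f 1 0 \<omega> - 2 * f 0 1 \<omega>) / 12)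
      ((e 1 1 + e 1 (- 1) - 2 * e 1 0 - 2 * e 0 1) / 12)"
    by (intro has_bochner_integral_divide_zero has_bochner_integral_diff has_bochner_integral_add
         has_bochner_integral_mult_right key)
  moreover have "(f 1 1 \<omega> + f 1 (- 1) \<omega> - 2 * f 1 0 \<omega> - 2 * f 0 1 \<omega>) / 12 = (X \<omega> + a)\<^sup>2 * (Y \<omega> + b)\<^sup>2" for \<omega>
  proof -
    have "f 1 1 \<omega> + f 1 (- 1) \<omega> - 2 * f 1 0 \<omega> - 2 * f 0 1 \<omega> = 12 * ((X \<omega> + a)\<^sup>2 * (Y \<omega> + b)\<^sup>2)"
      unfolding f_def by algebra
    then show ?thesis by simp
  qed
  moreover have "(e 1 1 + e 1 (- 1) - 2 * e 1 0 - 2 * e 0 1) / 12 = (p + a\<^sup>2) * (q + b\<^sup>2) + 2 * r\<^sup>2 + 4 * r * a * b"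
  proof -
    have "e 1 1 + e 1 (- 1) - 2 * e 1 0 - 2 * e 0 1 = 12 * ((p + a\<^sup>2) * (q + b\<^sup>2) + 2 * r\<^sup>2 + 4 * r * a * b)"
      unfolding e_def by algebra
    then show ?thesis by simp
  qed
  ultimately show ?thesis by simp
qed

lemma (in prob_space) gaussian_process_pair:
  assumes gp: "centered_gaussian_process M I X K" and t: "t \<in> I" and s: "s \<in> I"
  shows "gaussian_law (distr M borel (\<lambda>\<omega>. c * X t \<omega> + d * X s \<omega>))"
proof -
  have comb: "gaussian_law (distr M borel (\<lambda>\<omega>. \<Sum>i\<in>F. a i * X i \<omega>))" if "finite F" "F \<subseteq> I" for F a
    using gp that unfolding centered_gaussian_process_def by blast
  show ?thesis
  proof (cases "t = s")
    case True
    with comb[of "{t}" "\<lambda>_. c + d"] t show ?thesis by (simp add: distrib_right)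
  next
    case False
    with comb[of "{t, s}" "\<lambda>i. if i = t then c else d"] t s show ?thesis by simp
  qed
qed

lemma (in prob_space) gaussian_process_integrable:
  assumes gp: "centered_gaussian_process M I X K" and t: "t \<in> I" and s: "s \<in> I"
  shows "integrable M (\<lambda>\<omega>. X t \<omega> * X s \<omega>)"
proof -
  have [measurable]: "X t \<in> borel_measurable M" "X s \<in> borel_measurable M"
    using gp t s unfolding centered_gaussian_process_def by auto
  have "integrable M (\<lambda>\<omega>. X i \<omega> ^ 2)" if "i \<in> I" for i
    using gaussian_process_pair[OF gp that that, of 1 0] gp that
    unfolding centered_gaussian_process_def by (intro centered_gaussian_moments) auto
  then show ?thesis
    using t s by (intro integrable_mult_of_squares[of "X t" M "X s"]) (auto simp: power2_eq_square)
qed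

lemma (in prob_space) gaussian_process_square_moment:
  assumes gp: "centered_gaussian_process M I X K" and F: "finite F" "F \<subseteq> I"
  shows "has_bochner_integral M (\<lambda>\<omega>. (\<Sum>t\<in>F. a t * X t \<omega>)\<^sup>2) (\<Sum>t\<in>F. \<Sum>s\<in>F. a t * a s * K t s)"
proof -
  have "has_bochner_integral M (\<lambda>\<omega>. \<Sum>t\<in>F. \<Sum>s\<in>F. a t * a s * (X t \<omega> * X s \<omega>)) (\<Sum>t\<in>F. \<Sum>s\<in>F. a t * a s * K t s)"
  proof (intro has_bochner_integral_sum has_bochner_integral_mult_right)
    fix t s assume "t \<in> F" "s \<in> F"
    then have ts: "t \<in> I" "s \<in> I" using F by auto
    then have "expectation (\<lambda>\<omega>. X t \<omega> * X s \<omega>) = K t s"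
      using gp unfolding centered_gaussian_process_def by blast
    then show "has_bochner_integral M (\<lambda>\<omega>. X t \<omega> * X s \<omega>) (K t s)"
      using gaussian_process_integrable[OF gp ts] by (simp add: has_bochner_integral_iff)
  qed
  moreover have "(\<Sum>t\<in>F. a t * X t \<omega>)\<^sup>2 = (\<Sum>t\<in>F. \<Sum>s\<in>F. a t * a s * (X t \<omega> * X s \<omega>))" for \<omega>
    by (simp add: power2_eq_square sum_product mult_ac)
  ultimately show ?thesis by simp
qed

section \<open>Bounded functionals on the span of the kernel functions\<close>

text \<open>
  The value at \<open>f\<close> of the combination of evaluations with coefficients \<open>c\<close>. If \<open>f\<close> lies in the
  reproducing kernel Hilbert space, this is the inner product of \<open>f\<close> with \<open>kernel_comb K c\<close>.
\<close>

definition fin_eval :: "('i \<Rightarrow> real) \<Rightarrow> ('i \<Rightarrow>\<^sub>0 real) \<Rightarrow> real" where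
  "fin_eval f c = (\<Sum>t\<in>Poly_Mapping.keys c. Poly_Mapping.lookup c t * f t)"

lemma fin_eval_superset:
  assumes "finite A" "Poly_Mapping.keys c \<subseteq> A"
  shows "fin_eval f c = (\<Sum>t\<in>A. Poly_Mapping.lookup c t * f t)"
  unfolding fin_eval_def using assms
  by (intro sum.mono_neutral_left) (auto simp: in_keys_iff)

lemma fin_eval_add: "fin_eval f (c + d) = fin_eval f c + fin_eval f d"
proof -
  let ?A = "Poly_Mapping.keys c \<union> Poly_Mapping.keys d"
  have "Poly_Mapping.keys (c + d) \<subseteq> ?A" by (rule Poly_Mapping.keys_add)
  then show ?thesis
    by (simp add: fin_eval_superset[of ?A] lookup_add distrib_right sum.distrib)
qed

lemma fin_eval_single: "fin_eval f (Poly_Mapping.single s x) = x * f s"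
  by (cases "x = 0") (auto simp: fin_eval_def)

definition fin_scale :: "real \<Rightarrow> ('i \<Rightarrow>\<^sub>0 real) \<Rightarrow> ('i \<Rightarrow>\<^sub>0 real)" where
  "fin_scale x c = Poly_Mapping.map ((*) x) c"

lemma lookup_fin_scale: "Poly_Mapping.lookup (fin_scale x c) t = x * Poly_Mapping.lookup c t"
  by (simp add: fin_scale_def Poly_Mapping.map.rep_eq when_def)

lemma keys_fin_scale: "Poly_Mapping.keys (fin_scale x c) \<subseteq> Poly_Mapping.keys c"
  by (auto simp: in_keys_iff lookup_fin_scale)

lemma fin_eval_scale: "fin_eval f (fin_scale x c) = x * fin_eval f c"
  unfolding fin_eval_superset[OF finite_keys keys_fin_scale]
  by (simp add: lookup_fin_scale fin_eval_def sum_distrib_left mult.assoc)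

lemma fin_eval_diff: "fin_eval f (c - d) = fin_eval f c - fin_eval f d"
  using fin_eval_add[of f "c - d" d] by simp

lemma kernel_comb_eq_fin_eval: "kernel_comb K c s = fin_eval (\<lambda>t. K t s) c"
  by (simp add: kernel_comb_def fin_eval_def)

lemma kernel_inner_eq_fin_eval: "kernel_inner K c d = fin_eval (kernel_comb K c) d"
  by (simp add: kernel_inner_eq_sum_kernel_comb fin_eval_def)

lemma kernel_inner_commute:
  assumes "\<And>t s. K t s = K s t"
  shows "kernel_inner K c d = kernel_inner K d c"
  unfolding kernel_inner_def
  by (subst sum.swap, rule sum.cong[OF refl], rule sum.cong[OF refl]) (simp add: assms mult_ac)

lemma kernel_inner_add_right: "kernel_inner K c (d + e) = kernel_inner K c d + kernel_inner K c e"
  by (simp add: kernel_inner_eq_fin_eval fin_eval_add)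

lemma kernel_inner_diff_right: "kernel_inner K c (d - e) = kernel_inner K c d - kernel_inner K c e"
  by (simp add: kernel_inner_eq_fin_eval fin_eval_diff)

lemma kernel_inner_scale_right: "kernel_inner K c (fin_scale x d) = x * kernel_inner K c d"
  by (simp add: kernel_inner_eq_fin_eval fin_eval_scale)

lemma kernel_inner_single_right: "kernel_inner K c (Poly_Mapping.single s x) = x * kernel_comb K c s"
  by (simp add: kernel_inner_eq_fin_eval fin_eval_single)

text \<open>
  This is the Riesz representation theorem for the completion of the span, in the direction that
  produces the representing element: the minimizer of \<open>\<parallel>c\<parallel>\<^sup>2 - 2 * fin_eval f c\<close> would be the
  representer, so a minimizing sequence is Cauchy by the parallelogram law, and moving it in the
  direction of a kernel function shows that its values converge to those of \<open>f\<close>.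
\<close>

lemma in_rkhs_if_bounded_functional:
  fixes K :: "'i \<Rightarrow> 'i \<Rightarrow> real"
  assumes sym: "\<And>t s. K t s = K s t"
    and zero: "\<And>s. s \<notin> I \<Longrightarrow> f s = 0"
    and C: "C > 0"
    and bound: "\<And>c. Poly_Mapping.keys c \<subseteq> I \<Longrightarrow> (fin_eval f c)\<^sup>2 \<le> C * kernel_inner K c c"
  shows "f \<in> rkhs I K"
proof -
  define V where "V = {c :: 'i \<Rightarrow>\<^sub>0 real. Poly_Mapping.keys c \<subseteq> I}"
  define J where "J c = kernel_inner K c c - 2 * fin_eval f c" for c
  define m where "m = (INF c\<in>V. J c)"
  have V_add: "c + d \<in> V" if "c \<in> V" "d \<in> V" for c d
    using that Poly_Mapping.keys_add[of c d] unfolding V_def by blast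
  have V_scale: "fin_scale x c \<in> V" if "c \<in> V" for c x
    using that keys_fin_scale[of x c] unfolding V_def by blast
  have V_single: "Poly_Mapping.single s x \<in> V" if "s \<in> I" for s x
    using that unfolding V_def by simp
  have "0 \<in> V" by (simp add: V_def)
  have "J c \<ge> - C" if "c \<in> V" for c
  proof -
    have "(fin_eval f c)\<^sup>2 / C \<le> kernel_inner K c c"
      using bound[of c] that C by (simp add: V_def divide_le_eq mult.commute)
    moreover have "0 \<le> (fin_eval f c / sqrt C - sqrt C)\<^sup>2" by simp
    then have "2 * fin_eval f c \<le> (fin_eval f c)\<^sup>2 / C + C"
      using C by (simp add: power2_diff power_divide)
    ultimately show ?thesis unfolding J_def by linarith
  qed
  then have bdd: "bdd_below (J ` V)" by (auto intro!: bdd_belowI2)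
  have m: "m \<le> J c" if "c \<in> V" for c
    unfolding m_def by (rule cINF_lower[OF bdd that])
  have "\<exists>c\<in>V. J c < m + 1 / real (Suc n)" for n
    using cINF_less_iff[of V J "m + 1 / real (Suc n)"] bdd \<open>0 \<in> V\<close> unfolding m_def by auto
  then obtain c where cV: "\<And>n. c n \<in> V" and cJ: "\<And>n. J (c n) < m + 1 / real (Suc n)"
    by metis
  \<comment> \<open>The terms linear in \<open>a\<close> and \<open>b\<close> cancel, so \<open>J\<close> satisfies the parallelogram law.\<close>
  have parallelogram: "kernel_inner K (a - b) (a - b)
      = 2 * J a + 2 * J b - 4 * J (fin_scale (1 / 2) (a + b))" for a b
  proof -
    have left: "kernel_inner K (a - b) x = kernel_inner K a x - kernel_inner K b x"
      "kernel_inner K (a + b) x = kernel_inner K a x + kernel_inner K b x"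
      "kernel_inner K (fin_scale y d) x = y * kernel_inner K d x" for x y d
      using kernel_inner_diff_right[of K x a b] kernel_inner_add_right[of K x a b]
        kernel_inner_scale_right[of K x y d]
      by (simp_all add: kernel_inner_commute[OF sym, where c = x])
    show ?thesis
      unfolding J_def left kernel_inner_add_right kernel_inner_diff_right kernel_inner_scale_right
        fin_eval_add fin_eval_scale kernel_inner_commute[OF sym, where c = b and d = a]
      by (simp add: field_simps)
  qed
  have diff: "kernel_inner K (c i - c j) (c i - c j) < 2 / real (Suc i) + 2 / real (Suc j)" for i j
  proof -
    have "m \<le> J (fin_scale (1 / 2) (c i + c j))" by (intro m V_scale V_add cV)
    then have "kernel_inner K (c i - c j) (c i - c j) \<le> 2 * (J (c i) - m) + 2 * (J (c j) - m)"
      unfolding parallelogram by (simp add: right_diff_distrib)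
    also have "\<dots> < 2 * (1 / real (Suc i)) + 2 * (1 / real (Suc j))"
    proof (intro add_strict_mono mult_strict_left_mono)
      show "J (c i) - m < 1 / real (Suc i)" "J (c j) - m < 1 / real (Suc j)"
        using cJ[of i] cJ[of j] by linarith+
    qed auto
    finally show ?thesis by simp
  qed
  have cauchy: "\<exists>N. \<forall>i\<ge>N. \<forall>j\<ge>N. sqrt (kernel_inner K (c i - c j) (c i - c j)) < e" if "e > 0" for e
  proof -
    obtain N where N: "inverse (real (Suc N)) < e\<^sup>2 / 4"
      using reals_Archimedean[of "e\<^sup>2 / 4"] \<open>e > 0\<close> by force
    have "sqrt (kernel_inner K (c i - c j) (c i - c j)) < e" if "i \<ge> N" "j \<ge> N" for i j
    proof -
      have "1 / real (Suc i) \<le> 1 / real (Suc N)" "1 / real (Suc j) \<le> 1 / real (Suc N)"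
        using that by (auto intro!: divide_left_mono)
      then have "2 / real (Suc i) + 2 / real (Suc j) \<le> 4 * inverse (real (Suc N))"
        by (simp add: inverse_eq_divide)
      also have "\<dots> < e\<^sup>2" using N by simp
      finally have "kernel_inner K (c i - c j) (c i - c j) < e\<^sup>2" using diff[of i j] by (rule less_trans[rotated])
      then show ?thesis using \<open>e > 0\<close> real_less_lsqrt by simp
    qed
    then show ?thesis by blast
  qed
  have ptw: "(\<lambda>n. kernel_comb K (c n) s) \<longlonglongrightarrow> f s" if s: "s \<in> I" for s
  proof -
    have "K s s \<ge> 0"
    proof -
      have "0 \<le> C * kernel_inner K (Poly_Mapping.single s 1) (Poly_Mapping.single s 1)"
        using bound[of "Poly_Mapping.single s 1"] s by (auto intro: order_trans[OF zero_le_power2])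
      then show ?thesis
        using C by (simp add: kernel_inner_single_right kernel_comb_eq_fin_eval fin_eval_single zero_le_mult_iff)
    qed
    have D: "(kernel_comb K (c n) s - f s)\<^sup>2 \<le> (K s s + 1) * (1 / real (Suc n))" for n
    proof -
      define D where "D = kernel_comb K (c n) s - f s"
      \<comment> \<open>Nearly the minimum of the quadratic in \<open>x\<close>; adding 1 avoids division by zero.\<close>
      define x where "x = - D / (K s s + 1)"
      let ?e = "Poly_Mapping.single s x"
      have ce: "kernel_inner K (c n + ?e) (c n + ?e)
          = kernel_inner K (c n) (c n) + 2 * kernel_inner K (c n) ?e + kernel_inner K ?e ?e"
        using kernel_inner_add_right[of K "c n + ?e" "c n" ?e]
          kernel_inner_add_right[of K "c n" "c n" ?e] kernel_inner_add_right[of K ?e "c n" ?e]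
          kernel_inner_commute[OF sym, where c = "c n + ?e" and d = "c n"]
          kernel_inner_commute[OF sym, where c = "c n + ?e" and d = ?e]
          kernel_inner_commute[OF sym, where c = ?e and d = "c n"]
        by simp
      have ee: "kernel_comb K ?e s = x * K s s"
        unfolding kernel_comb_eq_fin_eval fin_eval_single by (rule refl)
      have "J (c n + ?e) = J (c n) + (2 * (x * D) + x\<^sup>2 * K s s)"
        unfolding J_def D_def ce fin_eval_add fin_eval_single kernel_inner_single_right ee
        by (simp add: algebra_simps power2_eq_square)
      moreover have "m \<le> J (c n + ?e)" by (intro m V_add cV V_single s)
      ultimately have *: "- (2 * (x * D) + x\<^sup>2 * K s s) < 1 / real (Suc n)"
        using cJ[of n] by simp
      have xK: "x * (K s s + 1) = - D" unfolding x_def using \<open>K s s \<ge> 0\<close> by simp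
      have "- (x * D) \<le> - (2 * (x * D) + x\<^sup>2 * K s s)"
      proof -
        have "- (2 * (x * D) + x\<^sup>2 * K s s) = - (x * D) + x\<^sup>2"
          using xK by algebra
        moreover have "0 \<le> x\<^sup>2" by simp
        ultimately show ?thesis by simp
      qed
      also note *
      finally have "- (x * D) \<le> 1 / real (Suc n)" by (rule less_imp_le)
      then have "(K s s + 1) * (- (x * D)) \<le> (K s s + 1) * (1 / real (Suc n))"
        using \<open>K s s \<ge> 0\<close> by (intro mult_left_mono) auto
      moreover have "D\<^sup>2 = (K s s + 1) * (- (x * D))" using xK by algebra
      ultimately show ?thesis unfolding D_def by simp
    qed
    have "(\<lambda>n. (K s s + 1) * inverse (real (Suc n))) \<longlonglongrightarrow> (K s s + 1) * 0"
      by (rule tendsto_mult_left[OF LIMSEQ_inverse_real_of_nat])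
    then have lim: "(\<lambda>n. (K s s + 1) * (1 / real (Suc n))) \<longlonglongrightarrow> 0"
      by (simp add: inverse_eq_divide)
    have "(\<lambda>n. (kernel_comb K (c n) s - f s)\<^sup>2) \<longlonglongrightarrow> 0"
      by (rule tendsto_sandwich[OF _ _ tendsto_const lim]) (use D in \<open>auto intro!: always_eventually\<close>)
    from tendsto_real_sqrt[OF this] have "(\<lambda>n. kernel_comb K (c n) s - f s) \<longlonglongrightarrow> 0"
      by (simp add: tendsto_rabs_zero_iff)
    then show ?thesis
      by (simp add: LIM_zero_iff)
  qed
  show ?thesis
    unfolding rkhs_def using zero cV cauchy ptw
    by (intro CollectI conjI allI impI exI[of _ c] ballI) (simp_all add: V_def)
qed

section \<open>Fractional Brownian motion in logarithmic time\<close>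

lemma fbm_cov_commute: "fbm_cov H t s = fbm_cov H s t"
  by (simp add: fbm_cov_def abs_minus_commute)

lemma fbm_cov_scale:
  assumes "c \<ge> 0" "t \<ge> 0" "s \<ge> 0"
  shows "fbm_cov H (c * t) (c * s) = c powr (2 * H) * fbm_cov H t s"
proof -
  have "\<bar>c * t - c * s\<bar> = c * \<bar>t - s\<bar>"
    using assms(1) by (metis abs_mult abs_of_nonneg right_diff_distrib)
  then show ?thesis
    using assms by (simp add: fbm_cov_def powr_mult algebra_simps)
qed

text \<open>
  The covariance of the stationary Gaussian process \<open>u \<mapsto> exp (- H * u) * w (exp u)\<close> obtained from
  fractional Brownian motion by the Lamperti transform.
\<close>

definition log_corr :: "real \<Rightarrow> real \<Rightarrow> real \<Rightarrow> real" where
  "log_corr H u v = exp (- (H * u)) * exp (- (H * v)) * fbm_cov H (exp u) (exp v)"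

lemma log_corr_self: "log_corr H u u = 1"
proof -
  have "fbm_cov H (exp u) (exp u) = exp (2 * H * u)"
    by (simp add: fbm_cov_def powr_def)
  then have "log_corr H u u = exp (- (H * u) + - (H * u) + 2 * H * u)"
    by (simp only: log_corr_def exp_add)
  then show ?thesis by simp
qed

lemma log_corr_commute: "log_corr H u v = log_corr H v u"
  by (simp add: log_corr_def fbm_cov_commute[of H "exp u"])

text \<open>
  With \<open>q = exp (- \<bar>u - v\<bar>)\<close> the correlation is \<open>q powr (- H)\<close> times
  \<open>(1 + q powr (2 * H) - (1 - q) powr (2 * H)) / 2\<close>, and the last factor is of order \<open>q\<close> because
  \<open>1 \<le> 2 * H \<le> 2\<close>.
\<close>

lemma log_corr_decay:
  assumes H: "1 / 2 < H" "H < 1"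
  shows "0 \<le> log_corr H u v" and "log_corr H u v \<le> 2 * exp (- ((1 - H) * \<bar>u - v\<bar>))"
proof -
  have *: "0 \<le> log_corr H u v \<and> log_corr H u v \<le> 2 * exp (- ((1 - H) * \<bar>u - v\<bar>))"
    if uv: "v \<le> u" for u v
  proof -
    define q where "q = exp (v - u)"
    have q: "0 < q" "q \<le> 1" using uv by (auto simp: q_def)
    have v: "exp v = exp u * q" by (simp add: q_def exp_diff)
    have "fbm_cov H (exp u) (exp v) = fbm_cov H (exp u * 1) (exp u * q)" by (simp add: v)
    also have "\<dots> = exp u powr (2 * H) * fbm_cov H 1 q"
      using q by (intro fbm_cov_scale) auto
    also have "exp u powr (2 * H) = exp (2 * H * u)" by (simp add: powr_def)
    finally have "log_corr H u v = exp (- (H * u) + - (H * v) + 2 * H * u) * fbm_cov H 1 q"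
      by (simp only: log_corr_def exp_add mult.assoc)
    also have "- (H * u) + - (H * v) + 2 * H * u = H * (u - v)" by (simp add: algebra_simps)
    finally have corr: "log_corr H u v = exp (H * (u - v)) * fbm_cov H 1 q" .
    have "q powr (2 * H) \<le> q powr 1"
      using q H by (intro powr_mono') auto
    then have 1: "q powr (2 * H) \<le> q" using q by simp
    have 2: "1 - 2 * q \<le> (1 - q) powr (2 * H)"
    proof (cases "q = 1")
      case False
      then have "q < 1" using q by simp
      then have "(1 - q) powr 2 \<le> (1 - q) powr (2 * H)"
        using q H by (intro powr_mono') auto
      moreover have "(1 - q) powr 2 = (1 - q)\<^sup>2" using \<open>q < 1\<close> by (simp add: powr_numeral)
      moreover have "1 - 2 * q \<le> (1 - q)\<^sup>2" by (simp add: power2_eq_square algebra_simps)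
      ultimately show ?thesis by linarith
    qed simp
    have 3: "(1 - q) powr (2 * H) \<le> 1"
      using q H powr_mono2[of "2 * H" "1 - q" 1] by simp
    have cov: "fbm_cov H 1 q = (1 + q powr (2 * H) - (1 - q) powr (2 * H)) / 2"
      using q by (simp add: fbm_cov_def)
    have "0 \<le> (1 + x - y) / 2 \<and> (1 + x - y) / 2 \<le> 2 * q"
      if "0 \<le> x" "x \<le> q" "1 - 2 * q \<le> y" "y \<le> 1" for x y :: real
      using that by (auto simp: divide_le_eq)
    from this[OF _ 1 2 3] have "0 \<le> fbm_cov H 1 q" and "fbm_cov H 1 q \<le> 2 * q"
      unfolding cov by auto
    then have "0 \<le> log_corr H u v" "log_corr H u v \<le> exp (H * (u - v)) * (2 * q)"
      unfolding corr by (auto intro!: mult_left_mono)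
    moreover have "exp (H * (u - v)) * q = exp (- ((1 - H) * \<bar>u - v\<bar>))"
      using uv by (simp add: q_def exp_add[symmetric] algebra_simps)
    ultimately show ?thesis by simp
  qed
  show "0 \<le> log_corr H u v" "log_corr H u v \<le> 2 * exp (- ((1 - H) * \<bar>u - v\<bar>))"
    using *[of u v] *[of v u] log_corr_commute[of H u v] abs_minus_commute[of u v]
    by (cases "v \<le> u"; simp)+
qed

section \<open>Averages over logarithmic time\<close>

lemma nn_integral_two_sided_exponential:
  assumes k: "k > 0"
  shows "(\<integral>\<^sup>+v. ennreal (exp (- (k * \<bar>u - v\<bar>))) \<partial>lborel) = ennreal (2 / k)"
proof -
  have one: "(\<integral>\<^sup>+v. ennreal (exponential_density k v) \<partial>lborel) = 1"
    using prob_space.emeasure_space_1[OF prob_space_exponential_density[OF k]]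
    by (simp add: emeasure_density)
  have one': "(\<integral>\<^sup>+v. ennreal (exponential_density k (- v)) \<partial>lborel) = 1"
    using nn_integral_real_affine[of "\<lambda>v. ennreal (exponential_density k v)" "- 1" 0] one by simp
  have "(\<integral>\<^sup>+v. ennreal (exp (- (k * \<bar>u - v\<bar>))) \<partial>lborel) = (\<integral>\<^sup>+v. ennreal (exp (- (k * \<bar>v\<bar>))) \<partial>lborel)"
    using nn_integral_real_affine[of "\<lambda>v. ennreal (exp (- (k * \<bar>u - v\<bar>)))" 1 u] by simp
  also have "\<dots> = (\<integral>\<^sup>+v. ennreal (1 / k) * (ennreal (exponential_density k v) + ennreal (exponential_density k (- v))) \<partial>lborel)"
  proof (rule nn_integral_cong_AE)
    show "AE v in lborel. ennreal (exp (- (k * \<bar>v\<bar>)))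
        = ennreal (1 / k) * (ennreal (exponential_density k v) + ennreal (exponential_density k (- v)))"
      using AE_lborel_singleton[of "0::real"]
    proof eventually_elim
      case (elim v)
      then show ?case
        using k by (cases "v > 0") (auto simp: exponential_density_def ennreal_mult'[symmetric] mult.commute)
    qed
  qed
  also have "\<dots> = ennreal (1 / k) * (1 + 1)"
    by (subst nn_integral_cmult) (auto simp: nn_integral_add one one')
  also have "(1 + 1 :: ennreal) = ennreal 2" by (simp add: ennreal_numeral[symmetric] del: ennreal_numeral) 
  also have "ennreal (1 / k) * ennreal 2 = ennreal (2 / k)"
    by (subst ennreal_mult'[symmetric]) (use k in auto)
  finally show ?thesis .
qed

definition laplace :: "real \<Rightarrow> real measure" where
  "laplace e = density lborel (\<lambda>u. ennreal (e / 2 * exp (- (e * \<bar>u\<bar>))))"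

lemma sets_laplace [measurable_cong, simp]: "sets (laplace e) = sets borel"
  by (simp add: laplace_def)

lemma space_laplace [simp]: "space (laplace e) = UNIV"
  by (simp add: laplace_def)

lemma nn_integral_laplace:
  assumes "f \<in> borel_measurable borel"
  shows "(\<integral>\<^sup>+u. f u \<partial>laplace e) = (\<integral>\<^sup>+u. ennreal (e / 2 * exp (- (e * \<bar>u\<bar>))) * f u \<partial>lborel)"
  unfolding laplace_def using assms by (intro nn_integral_density) auto

lemma prob_space_laplace:
  assumes "e > 0"
  shows "prob_space (laplace e)"
proof
  have "emeasure (laplace e) (space (laplace e)) = (\<integral>\<^sup>+u. 1 \<partial>laplace e)" by simp
  also have "\<dots> = (\<integral>\<^sup>+u. ennreal (e / 2) * ennreal (exp (- (e * \<bar>0 - u\<bar>))) \<partial>lborel)"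
    unfolding nn_integral_laplace[OF borel_measurable_const] mult_1_right diff_0 abs_minus_cancel
    using assms by (intro nn_integral_cong ennreal_mult') auto
  also have "\<dots> = ennreal (e / 2) * ennreal (2 / e)"
    using nn_integral_two_sided_exponential[OF assms, of 0] by (subst nn_integral_cmult) auto
  also have "\<dots> = 1" using assms by (simp add: ennreal_mult'[symmetric])
  finally show "emeasure (laplace e) (space (laplace e)) = 1" .
qed

text \<open>
  The average of the squared Lamperti transform of \<open>y\<close> against the two-sided exponential law with
  rate \<open>e\<close>, which spreads over all of logarithmic time as \<open>e\<close> tends to 0.
\<close>

definition log_energy :: "real \<Rightarrow> real \<Rightarrow> (real \<Rightarrow> real) \<Rightarrow> ennreal" where
  "log_energy H e y = (\<integral>\<^sup>+u. ennreal ((exp (- (H * u)) * y (exp u))\<^sup>2) \<partial>laplace e)"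

text \<open>
  A dilation of time is a translation by \<open>ln c\<close> of logarithmic time, and the translated weight
  differs from the original one by at most the factor \<open>exp (e * \<bar>ln c\<bar>)\<close>.
\<close>

lemma log_energy_dilation:
  assumes [measurable]: "y \<in> borel_measurable borel" and c: "c > 0" and e: "e > 0"
  shows "log_energy H e (\<lambda>t. y (t * c)) \<le> ennreal (exp (2 * H * ln c + e * \<bar>ln c\<bar>)) * log_energy H e y"
    and "ennreal (exp (2 * H * ln c - e * \<bar>ln c\<bar>)) * log_energy H e y \<le> log_energy H e (\<lambda>t. y (t * c))"
proof -
  define s where "s = ln c"
  have c: "c = exp s" using c by (simp add: s_def)
  let ?z = "\<lambda>u. (exp (- (H * u)) * y (exp u))\<^sup>2"
  let ?w = "\<lambda>u. e / 2 * exp (- (e * \<bar>u\<bar>))"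
  have scaled: "log_energy H e (\<lambda>t. y (t * c))
      = (\<integral>\<^sup>+u. ennreal (exp (2 * H * s) * ?w (u - s) * ?z u) \<partial>lborel)"
  proof -
    have "log_energy H e (\<lambda>t. y (t * c))
        = (\<integral>\<^sup>+u. ennreal (?w u) * ennreal ((exp (- (H * u)) * y (exp u * c))\<^sup>2) \<partial>lborel)"
      unfolding log_energy_def by (rule nn_integral_laplace) measurable
    also have "\<dots> = (\<integral>\<^sup>+u. ennreal (?w (u - s)) * ennreal ((exp (- (H * (u - s))) * y (exp (u - s) * c))\<^sup>2) \<partial>lborel)"
      using nn_integral_real_affine[of "\<lambda>u. ennreal (?w u) * ennreal ((exp (- (H * u)) * y (exp u * c))\<^sup>2)" 1 "- s"]
      by (simp add: add.commute)
    also have "\<dots> = (\<integral>\<^sup>+u. ennreal (exp (2 * H * s) * ?w (u - s) * ?z u) \<partial>lborel)"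
    proof (rule nn_integral_cong)
      fix u
      have "(exp (- (H * (u - s))) * y (exp (u - s) * c))\<^sup>2 = exp (2 * H * s) * ?z u"
      proof -
        have "exp (u - s) * c = exp u" by (simp add: c exp_diff)
        moreover have "exp (- (H * (u - s))) = exp (H * s) * exp (- (H * u))"
          by (simp add: exp_add[symmetric] algebra_simps)
        moreover have "(exp (H * s))\<^sup>2 = exp (2 * H * s)"
          by (simp add: power2_eq_square exp_add[symmetric])
        ultimately show ?thesis by (simp add: power_mult_distrib mult.assoc)
      qed
      then show "ennreal (?w (u - s)) * ennreal ((exp (- (H * (u - s))) * y (exp (u - s) * c))\<^sup>2)
          = ennreal (exp (2 * H * s) * ?w (u - s) * ?z u)"
        using e by (simp add: ennreal_mult'[symmetric] mult_ac)
    qed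
    finally show ?thesis .
  qed
  have energy: "ennreal a * log_energy H e y = (\<integral>\<^sup>+u. ennreal (a * ?w u * ?z u) \<partial>lborel)" if "a \<ge> 0" for a
  proof -
    have "ennreal a * log_energy H e y = ennreal a * (\<integral>\<^sup>+u. ennreal (?w u) * ennreal (?z u) \<partial>lborel)"
      unfolding log_energy_def by (subst nn_integral_laplace) measurable
    also have "\<dots> = (\<integral>\<^sup>+u. ennreal a * (ennreal (?w u) * ennreal (?z u)) \<partial>lborel)"
      by (rule nn_integral_cmult[symmetric]) measurable
    also have "\<dots> = (\<integral>\<^sup>+u. ennreal (a * ?w u * ?z u) \<partial>lborel)"
      using that e by (simp add: ennreal_mult'[symmetric] mult.assoc)
    finally show ?thesis .
  qed
  have w1: "exp (2 * H * s) * ?w (u - s) \<le> exp (2 * H * s + e * \<bar>s\<bar>) * ?w u" for u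
  proof -
    have "e * \<bar>u\<bar> \<le> e * (\<bar>u - s\<bar> + \<bar>s\<bar>)" using e by (intro mult_left_mono) auto
    then have "exp (2 * H * s - e * \<bar>u - s\<bar>) \<le> exp (2 * H * s + e * \<bar>s\<bar> - e * \<bar>u\<bar>)"
      by (simp add: distrib_left)
    then have "e / 2 * exp (2 * H * s - e * \<bar>u - s\<bar>) \<le> e / 2 * exp (2 * H * s + e * \<bar>s\<bar> - e * \<bar>u\<bar>)"
      using e by (intro mult_left_mono) auto
    then show ?thesis by (simp only: diff_conv_add_uminus exp_add mult_ac)
  qed
  have w2: "exp (2 * H * s - e * \<bar>s\<bar>) * ?w u \<le> exp (2 * H * s) * ?w (u - s)" for u
  proof -
    have "e * \<bar>u - s\<bar> \<le> e * (\<bar>u\<bar> + \<bar>s\<bar>)" using e by (intro mult_left_mono) auto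
    then have "exp (2 * H * s - e * \<bar>s\<bar> - e * \<bar>u\<bar>) \<le> exp (2 * H * s - e * \<bar>u - s\<bar>)"
      by (simp add: distrib_left)
    then have "e / 2 * exp (2 * H * s - e * \<bar>s\<bar> - e * \<bar>u\<bar>) \<le> e / 2 * exp (2 * H * s - e * \<bar>u - s\<bar>)"
      using e by (intro mult_left_mono) auto
    then show ?thesis by (simp only: diff_conv_add_uminus exp_add mult_ac)
  qed
  show "log_energy H e (\<lambda>t. y (t * c)) \<le> ennreal (exp (2 * H * ln c + e * \<bar>ln c\<bar>)) * log_energy H e y"
    unfolding scaled s_def[symmetric] energy[OF exp_ge_zero]
    using w1 by (intro nn_integral_mono ennreal_leI mult_right_mono) auto
  show "ennreal (exp (2 * H * ln c - e * \<bar>ln c\<bar>)) * log_energy H e y \<le> log_energy H e (\<lambda>t. y (t * c))"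
    unfolding scaled s_def[symmetric] energy[OF exp_ge_zero]
    using w2 by (intro nn_integral_mono ennreal_leI mult_right_mono) auto
qed

text \<open>
  This is how the random time scale becomes visible: the limit \<open>L\<close> is multiplied by
  \<open>c powr (2 * H)\<close>, which is \<open>\<tau>\<close> for \<open>c = \<tau> powr (1 / (2 * H))\<close>.
\<close>

lemma log_energy_dilation_limit:
  assumes y: "y \<in> borel_measurable borel" and c: "c > 0" and e: "\<And>k. e k > 0" "e \<longlonglongrightarrow> 0"
    and lim: "(\<lambda>k. log_energy H (e k) y) \<longlonglongrightarrow> L"
  shows "(\<lambda>k. log_energy H (e k) (\<lambda>t. y (t * c))) \<longlonglongrightarrow> ennreal (c powr (2 * H)) * L"
proof (rule tendsto_sandwich)
  have c': "c powr (2 * H) = exp (2 * H * ln c + 0 * \<bar>ln c\<bar>)" "c powr (2 * H) = exp (2 * H * ln c - 0 * \<bar>ln c\<bar>)"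
    using c by (simp_all add: powr_def)
  show "(\<lambda>k. ennreal (exp (2 * H * ln c - e k * \<bar>ln c\<bar>)) * log_energy H (e k) y) \<longlonglongrightarrow> ennreal (c powr (2 * H)) * L"
    unfolding c'(2) by (intro tendsto_mult_ennreal tendsto_ennrealI tendsto_exp tendsto_diff tendsto_mult e lim tendsto_const) auto
  show "(\<lambda>k. ennreal (exp (2 * H * ln c + e k * \<bar>ln c\<bar>)) * log_energy H (e k) y) \<longlonglongrightarrow> ennreal (c powr (2 * H)) * L"
    unfolding c'(1) by (intro tendsto_mult_ennreal tendsto_ennrealI tendsto_exp tendsto_add tendsto_mult e lim tendsto_const) auto
qed (use log_energy_dilation[OF y c e(1)] in auto)

section \<open>Concentration of the averages\<close>

lemma (in prob_space) fbm_log_time_moments: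
  fixes X :: "real \<Rightarrow> 'a \<Rightarrow> real"
  assumes gp: "centered_gaussian_process M {0..} X (fbm_cov H)"
  defines "Z u \<omega> \<equiv> exp (- (H * u)) * X (exp u) \<omega>"
  shows "(\<integral>\<^sup>+\<omega>. ennreal ((Z u \<omega> + a)\<^sup>2) \<partial>M) = ennreal (1 + a\<^sup>2)"
    and "(\<integral>\<^sup>+\<omega>. ennreal ((Z u \<omega> + a)\<^sup>2) * ennreal ((Z v \<omega> + b)\<^sup>2) \<partial>M)
      = ennreal ((1 + a\<^sup>2) * (1 + b\<^sup>2) + 2 * (log_corr H u v)\<^sup>2 + 4 * log_corr H u v * a * b)"
proof -
  have X [measurable]: "X (exp u) \<in> borel_measurable M" for u
    using gp unfolding centered_gaussian_process_def by simp
  have Z [measurable]: "Z u \<in> borel_measurable M" for u unfolding Z_def by measurable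
  have g: "gaussian_law (distr M borel (\<lambda>\<omega>. c * Z u \<omega> + d * Z v \<omega>))" for c d u v
    using gaussian_process_pair[OF gp, of "exp u" "exp v" "c * exp (- (H * u))" "d * exp (- (H * v))"]
    by (simp add: Z_def mult.assoc)
  have mean: "expectation (Z u) = 0" for u
    using gp unfolding Z_def centered_gaussian_process_def by simp
  have cov: "expectation (\<lambda>\<omega>. Z u \<omega> * Z v \<omega>) = log_corr H u v" for u v
  proof -
    have "expectation (\<lambda>\<omega>. X (exp u) \<omega> * X (exp v) \<omega>) = fbm_cov H (exp u) (exp v)"
      using gp unfolding centered_gaussian_process_def by simp
    moreover have "(\<lambda>\<omega>. Z u \<omega> * Z v \<omega>)
        = (\<lambda>\<omega>. (exp (- (H * u)) * exp (- (H * v))) * (X (exp u) \<omega> * X (exp v) \<omega>))"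
      by (rule ext) (simp add: Z_def mult_ac)
    ultimately show ?thesis by (simp add: log_corr_def)
  qed
  have var: "expectation (\<lambda>\<omega>. Z u \<omega> * Z u \<omega>) = 1" for u
    using cov[of u u] by (simp add: log_corr_self)
  have hb: "has_bochner_integral M (\<lambda>\<omega>. (Z u \<omega> + a)\<^sup>2 * (Z v \<omega> + b)\<^sup>2)
      ((1 + a\<^sup>2) * (1 + b\<^sup>2) + 2 * (log_corr H u v)\<^sup>2 + 4 * log_corr H u v * a * b)"
    by (rule gaussian_pair_moment[OF Z Z g mean mean var var cov])
  show "(\<integral>\<^sup>+\<omega>. ennreal ((Z u \<omega> + a)\<^sup>2) * ennreal ((Z v \<omega> + b)\<^sup>2) \<partial>M)
      = ennreal ((1 + a\<^sup>2) * (1 + b\<^sup>2) + 2 * (log_corr H u v)\<^sup>2 + 4 * log_corr H u v * a * b)"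
    using nn_integral_eq_integral[of M "\<lambda>\<omega>. (Z u \<omega> + a)\<^sup>2 * (Z v \<omega> + b)\<^sup>2"] hb
    by (simp add: has_bochner_integral_iff ennreal_mult')
  have gu: "gaussian_law (distr M borel (Z u))" using g[of 1 u 0 u] by simp
  have i: "integrable M (Z u)" "integrable M (\<lambda>\<omega>. (Z u \<omega>)\<^sup>2)"
    using centered_gaussian_moments(1)[OF Z gu mean, of 1] centered_gaussian_moments(1)[OF Z gu mean, of 2]
    by simp_all
  have e: "(\<lambda>\<omega>. (Z u \<omega> + a)\<^sup>2) = (\<lambda>\<omega>. (Z u \<omega>)\<^sup>2 + (2 * a) * Z u \<omega> + a\<^sup>2)"
    by (rule ext) (simp add: power2_eq_square algebra_simps)
  have "integrable M (\<lambda>\<omega>. (Z u \<omega> + a)\<^sup>2)" "expectation (\<lambda>\<omega>. (Z u \<omega> + a)\<^sup>2) = 1 + a\<^sup>2"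
    unfolding e using i var[of u] by (simp_all add: mean prob_space power2_eq_square)
  then show "(\<integral>\<^sup>+\<omega>. ennreal ((Z u \<omega> + a)\<^sup>2) \<partial>M) = ennreal (1 + a\<^sup>2)"
    using nn_integral_eq_integral[of M "\<lambda>\<omega>. (Z u \<omega> + a)\<^sup>2"] by simp
qed

text \<open>
  This is the formula for the variance; it is obtained by integrating
  \<open>(V - p)\<^sup>2 + 2 * p * V = V\<^sup>2 + p\<^sup>2\<close>, where all terms are nonnegative.
\<close>

lemma (in prob_space) second_moment_about_mean:
  assumes V [measurable]: "V \<in> borel_measurable M"
    and mean: "(\<integral>\<^sup>+\<omega>. V \<omega> \<partial>M) = ennreal p" and p: "p \<ge> 0"
    and second: "(\<integral>\<^sup>+\<omega>. V \<omega> * V \<omega> \<partial>M) \<le> ennreal (p * p + d)" and d: "d \<ge> 0"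
  shows "(\<integral>\<^sup>+\<omega>. ennreal ((enn2real (V \<omega>) - p)\<^sup>2) \<partial>M) \<le> ennreal d"
proof -
  have fin: "AE \<omega> in M. V \<omega> \<noteq> \<top>"
    using nn_integral_PInf_AE[OF V] mean by simp
  have "(\<integral>\<^sup>+\<omega>. ennreal ((enn2real (V \<omega>) - p)\<^sup>2) \<partial>M) + ennreal (2 * p * p)
      = (\<integral>\<^sup>+\<omega>. ennreal ((enn2real (V \<omega>) - p)\<^sup>2) \<partial>M) + (\<integral>\<^sup>+\<omega>. ennreal (2 * p) * V \<omega> \<partial>M)"
    using p by (simp add: nn_integral_cmult mean ennreal_mult'[symmetric])
  also have "\<dots> = (\<integral>\<^sup>+\<omega>. ennreal ((enn2real (V \<omega>) - p)\<^sup>2) + ennreal (2 * p) * V \<omega> \<partial>M)"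
    by (rule nn_integral_add[symmetric]) measurable
  also have "\<dots> = (\<integral>\<^sup>+\<omega>. V \<omega> * V \<omega> + ennreal (p * p) \<partial>M)"
  proof (rule nn_integral_cong_AE)
    show "AE \<omega> in M. ennreal ((enn2real (V \<omega>) - p)\<^sup>2) + ennreal (2 * p) * V \<omega> = V \<omega> * V \<omega> + ennreal (p * p)"
      using fin
    proof eventually_elim
      case (elim \<omega>)
      then obtain r where r: "V \<omega> = ennreal r" "r \<ge> 0" by (cases "V \<omega>") auto
      have "(r - p)\<^sup>2 + 2 * p * r = r * r + p * p" by (simp add: power2_eq_square algebra_simps)
      then show ?case
        using r p by (simp add: ennreal_mult'[symmetric] ennreal_plus[symmetric] del: ennreal_plus)
    qed
  qed
  also have "\<dots> = (\<integral>\<^sup>+\<omega>. V \<omega> * V \<omega> \<partial>M) + ennreal (p * p)"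
    by (simp add: nn_integral_add emeasure_space_1)
  also have "\<dots> \<le> ennreal (p * p + d) + ennreal (p * p)"
    using second by (rule add_right_mono)
  also have "\<dots> = ennreal d + ennreal (2 * p * p)"
    using p d by (simp add: ennreal_plus[symmetric] algebra_simps del: ennreal_plus)
  finally show ?thesis by (simp add: ennreal_add_left_cancel_le add.commute)
qed

lemma AE_tendsto_zero_if_summable_integrals:
  fixes X :: "nat \<Rightarrow> 'a \<Rightarrow> real"
  assumes [measurable]: "\<And>k. X k \<in> borel_measurable M"
    and nonneg: "\<And>k \<omega>. X k \<omega> \<ge> 0"
    and bound: "\<And>k. (\<integral>\<^sup>+\<omega>. ennreal (X k \<omega>) \<partial>M) \<le> ennreal (b k)"
    and b: "\<And>k. b k \<ge> 0" "summable b"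
  shows "AE \<omega> in M. (\<lambda>k. X k \<omega>) \<longlonglongrightarrow> 0"
proof -
  have "(\<integral>\<^sup>+\<omega>. suminf (\<lambda>k. ennreal (X k \<omega>)) \<partial>M) = suminf (\<lambda>k. \<integral>\<^sup>+\<omega>. ennreal (X k \<omega>) \<partial>M)"
    by (rule nn_integral_suminf) measurable
  also have "\<dots> \<le> suminf (\<lambda>k. ennreal (b k))"
    using bound by (intro suminf_le) auto
  also have "\<dots> = ennreal (suminf b)" by (rule suminf_ennreal2[OF b])
  also have "\<dots> < \<top>" by simp
  finally have "AE \<omega> in M. suminf (\<lambda>k. ennreal (X k \<omega>)) \<noteq> \<top>"
    using nn_integral_PInf_AE[of "\<lambda>\<omega>. suminf (\<lambda>k. ennreal (X k \<omega>))" M] by simp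
  then show ?thesis
  proof eventually_elim
    case (elim \<omega>)
    then have "summable (\<lambda>k. X k \<omega>)"
      using nonneg by (intro summable_suminf_not_top) auto
    then show ?case by (rule summable_LIMSEQ_zero)
  qed
qed

locale fbm_paths =
  fixes H :: real and P :: "wpath measure"
  assumes H: "1 / 2 < H" "H < 1" and fbm: "is_fbm_law H P"
begin

sublocale P: prob_space P
  using fbm unfolding is_fbm_law_def by blast

lemma sets_P [measurable_cong, simp]: "sets P = sets borel"
  using fbm unfolding is_fbm_law_def by blast

lemma space_P [simp]: "space P = UNIV"
  using sets_eq_imp_space_eq[OF sets_P] by simp

lemma gaussian: "centered_gaussian_process P {0..} (\<lambda>t w. path_at w t) (fbm_cov H)"
  using fbm unfolding is_fbm_law_def by blast

text \<open>
  By Tonelli the second moment is a double average over two times \<open>u\<close> and \<open>v\<close>. There Wick's formula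
  gives the product of the expectations and terms that carry the correlation of the two times, and
  the correlation has average \<open>O(e)\<close> in \<open>v\<close>, uniformly in \<open>u\<close>. The cross terms \<open>r * g u * g v\<close> with
  the shift are absorbed by \<open>2 * g u * g v \<le> (g u)\<^sup>2 + (g v)\<^sup>2\<close>, so that only the energy of the shift
  enters the bound.
\<close>

lemma shifted_energy_moments:
  assumes y [measurable]: "y \<in> borel_measurable borel" and e: "e > 0"
  defines "V w \<equiv> log_energy H e (\<lambda>t. path_at w t + y t)"
  shows "(\<integral>\<^sup>+w. V w \<partial>P) = 1 + log_energy H e y"
    and "(\<integral>\<^sup>+w. V w * V w \<partial>P) \<le> (1 + log_energy H e y) * (1 + log_energy H e y)
        + ennreal (8 * e / (1 - H)) * (1 + log_energy H e y)"
    and "V \<in> borel_measurable P"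
proof -
  interpret L: prob_space "laplace e" using e by (rule prob_space_laplace)
  interpret PL: pair_sigma_finite P "laplace e" ..
  interpret LL: pair_sigma_finite "laplace e" "laplace e" ..
  define g where "g u = exp (- (H * u)) * y (exp u)" for u
  define f where "f w u = ennreal ((exp (- (H * u)) * path_at w (exp u) + g u)\<^sup>2)" for w u
  define \<phi> where "\<phi> u = ennreal (1 + (g u)\<^sup>2)" for u
  define \<rho> where "\<rho> u v = ennreal (2 * exp (- ((1 - H) * \<bar>u - v\<bar>)))" for u v
  define \<delta> where "\<delta> = ennreal (2 * e / (1 - H))"
  have g_meas [measurable]: "g \<in> borel_measurable borel" unfolding g_def by measurable
  have f_meas [measurable]: "(\<lambda>(w, u). f w u) \<in> borel_measurable (borel \<Otimes>\<^sub>M borel)"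
    unfolding f_def by measurable
  have \<phi>_meas [measurable]: "\<phi> \<in> borel_measurable borel" unfolding \<phi>_def by measurable
  have \<rho>_meas [measurable]: "(\<lambda>(u, v). \<rho> u v) \<in> borel_measurable (borel \<Otimes>\<^sub>M borel)"
    unfolding \<rho>_def by measurable
  have V: "V w = (\<integral>\<^sup>+u. f w u \<partial>laplace e)" for w
    unfolding V_def log_energy_def f_def g_def by (simp add: distrib_left)
  show V_meas [measurable]: "V \<in> borel_measurable P" unfolding V by measurable
  have \<phi>_int: "(\<integral>\<^sup>+u. \<phi> u \<partial>laplace e) = 1 + log_energy H e y"
  proof -
    have "(\<integral>\<^sup>+u. \<phi> u \<partial>laplace e) = (\<integral>\<^sup>+u. 1 + ennreal ((g u)\<^sup>2) \<partial>laplace e)"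
      unfolding \<phi>_def by (simp add: ennreal_plus)
    also have "\<dots> = 1 + (\<integral>\<^sup>+u. ennreal ((g u)\<^sup>2) \<partial>laplace e)"
      by (subst nn_integral_add) (auto simp: L.emeasure_space_1[simplified])
    finally show ?thesis by (simp add: log_energy_def g_def)
  qed
  have f1: "(\<integral>\<^sup>+w. f w u \<partial>P) = \<phi> u" for u
    unfolding f_def \<phi>_def by (rule P.fbm_log_time_moments(1)[OF gaussian])
  have "(\<integral>\<^sup>+w. V w \<partial>P) = (\<integral>\<^sup>+u. \<integral>\<^sup>+w. f w u \<partial>P \<partial>laplace e)"
    unfolding V by (rule PL.Fubini'[where f = f, symmetric]) measurable
  then show "(\<integral>\<^sup>+w. V w \<partial>P) = 1 + log_energy H e y"
    by (simp add: f1 \<phi>_int)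
  have f2: "(\<integral>\<^sup>+w. f w u * f w v \<partial>P) \<le> \<phi> u * \<phi> v + 2 * \<rho> u v * \<phi> u + 2 * \<rho> u v * \<phi> v" for u v
  proof -
    define r where "r = log_corr H u v"
    define q where "q = 2 * exp (- ((1 - H) * \<bar>u - v\<bar>))"
    have r: "0 \<le> r" "r \<le> q" unfolding r_def q_def by (rule log_corr_decay[OF H])+
    have "0 \<le> (1 - H) * \<bar>u - v\<bar>" using H by simp
    then have "q \<le> 2" unfolding q_def by simp
    have "2 * r\<^sup>2 \<le> 4 * q"
    proof -
      have "r * r \<le> q * 2" using r \<open>q \<le> 2\<close> by (intro mult_mono) auto
      then show ?thesis by (simp add: power2_eq_square)
    qed
    moreover have "4 * r * g u * g v \<le> 2 * q * ((g u)\<^sup>2 + (g v)\<^sup>2)"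
    proof -
      have "r * (2 * g u * g v) \<le> r * ((g u)\<^sup>2 + (g v)\<^sup>2)"
        using r sum_squares_bound[of "g u" "g v"] by (intro mult_left_mono) auto
      also have "\<dots> \<le> q * ((g u)\<^sup>2 + (g v)\<^sup>2)" using r by (intro mult_right_mono) auto
      finally show ?thesis by simp
    qed
    ultimately have "2 * r\<^sup>2 + 4 * r * g u * g v \<le> 4 * q + 2 * q * ((g u)\<^sup>2 + (g v)\<^sup>2)"
      by (rule add_mono)
    then have "(1 + (g u)\<^sup>2) * (1 + (g v)\<^sup>2) + 2 * r\<^sup>2 + 4 * r * g u * g v
        \<le> (1 + (g u)\<^sup>2) * (1 + (g v)\<^sup>2) + 2 * q * (1 + (g u)\<^sup>2) + 2 * q * (1 + (g v)\<^sup>2)"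
      by (simp add: algebra_simps)
    then have "(\<integral>\<^sup>+w. f w u * f w v \<partial>P)
        \<le> ennreal ((1 + (g u)\<^sup>2) * (1 + (g v)\<^sup>2) + 2 * q * (1 + (g u)\<^sup>2) + 2 * q * (1 + (g v)\<^sup>2))"
      unfolding f_def P.fbm_log_time_moments(2)[OF gaussian] r_def by (rule ennreal_leI)
    also have "\<dots> = ennreal ((1 + (g u)\<^sup>2) * (1 + (g v)\<^sup>2)) + ennreal (2 * q * (1 + (g u)\<^sup>2)) + ennreal (2 * q * (1 + (g v)\<^sup>2))"
      using r by (simp add: ennreal_plus)
    also have "\<dots> = \<phi> u * \<phi> v + 2 * \<rho> u v * \<phi> u + 2 * \<rho> u v * \<phi> v"
    proof -
      have "ennreal (2 * q * z) = 2 * \<rho> u v * ennreal z" for z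
        unfolding \<rho>_def q_def[symmetric] using r
        by (metis ennreal_mult' ennreal_numeral mult_nonneg_nonneg order_trans zero_le_numeral)
      then show ?thesis unfolding \<phi>_def by (simp add: ennreal_mult')
    qed
    finally show ?thesis .
  qed
  have \<rho>_int: "(\<integral>\<^sup>+v. \<rho> u v \<partial>laplace e) \<le> \<delta>" for u
  proof -
    have "(\<integral>\<^sup>+v. \<rho> u v \<partial>laplace e) = (\<integral>\<^sup>+v. ennreal (e / 2 * exp (- (e * \<bar>v\<bar>))) * \<rho> u v \<partial>lborel)"
      by (rule nn_integral_laplace) measurable
    also have "\<dots> \<le> (\<integral>\<^sup>+v. ennreal e * ennreal (exp (- ((1 - H) * \<bar>u - v\<bar>))) \<partial>lborel)"
    proof (rule nn_integral_mono)
      fix v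
      have "exp (- (e * \<bar>v\<bar>)) \<le> 1" using e by simp
      then have "e * (exp (- (e * \<bar>v\<bar>)) * exp (- ((1 - H) * \<bar>u - v\<bar>))) \<le> e * (1 * exp (- ((1 - H) * \<bar>u - v\<bar>)))"
        using e by (intro mult_left_mono mult_right_mono) auto
      then show "ennreal (e / 2 * exp (- (e * \<bar>v\<bar>))) * \<rho> u v \<le> ennreal e * ennreal (exp (- ((1 - H) * \<bar>u - v\<bar>)))"
        unfolding \<rho>_def using e by (simp add: ennreal_mult'[symmetric] mult.assoc)
    qed
    also have "\<dots> = ennreal e * ennreal (2 / (1 - H))"
      using nn_integral_two_sided_exponential[of "1 - H" u] H by (subst nn_integral_cmult) auto
    also have "\<dots> = \<delta>" unfolding \<delta>_def using e H by (simp add: ennreal_mult'[symmetric])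
    finally show ?thesis .
  qed
  let ?\<Phi> = "\<integral>\<^sup>+u. \<phi> u \<partial>laplace e"
  have i1: "(\<integral>\<^sup>+u. \<integral>\<^sup>+v. \<phi> u * \<phi> v \<partial>laplace e \<partial>laplace e) = ?\<Phi> * ?\<Phi>"
    by (simp add: nn_integral_cmult nn_integral_multc)
  have i2: "(\<integral>\<^sup>+u. \<integral>\<^sup>+v. 2 * \<rho> u v * \<phi> u \<partial>laplace e \<partial>laplace e) \<le> 2 * \<delta> * ?\<Phi>"
  proof -
    have "(\<integral>\<^sup>+u. \<integral>\<^sup>+v. 2 * \<rho> u v * \<phi> u \<partial>laplace e \<partial>laplace e)
        = (\<integral>\<^sup>+u. 2 * (\<integral>\<^sup>+v. \<rho> u v \<partial>laplace e) * \<phi> u \<partial>laplace e)"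
      by (simp add: nn_integral_cmult nn_integral_multc)
    also have "\<dots> \<le> (\<integral>\<^sup>+u. 2 * \<delta> * \<phi> u \<partial>laplace e)"
      using \<rho>_int by (intro nn_integral_mono mult_right_mono mult_left_mono) auto
    finally show ?thesis by (simp add: nn_integral_cmult)
  qed
  have i3: "(\<integral>\<^sup>+u. \<integral>\<^sup>+v. 2 * \<rho> u v * \<phi> v \<partial>laplace e \<partial>laplace e) \<le> 2 * \<delta> * ?\<Phi>"
  proof -
    have "(\<integral>\<^sup>+u. \<integral>\<^sup>+v. 2 * \<rho> u v * \<phi> v \<partial>laplace e \<partial>laplace e)
        = (\<integral>\<^sup>+v. \<integral>\<^sup>+u. 2 * \<rho> u v * \<phi> v \<partial>laplace e \<partial>laplace e)"
      by (rule LL.Fubini'[where f = "\<lambda>u v. 2 * \<rho> u v * \<phi> v", symmetric]) measurable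
    also have "\<dots> = (\<integral>\<^sup>+v. \<integral>\<^sup>+u. 2 * \<rho> v u * \<phi> v \<partial>laplace e \<partial>laplace e)"
      by (simp add: \<rho>_def abs_minus_commute)
    finally show ?thesis using i2 by simp
  qed
  have "(\<integral>\<^sup>+w. V w * V w \<partial>P) = (\<integral>\<^sup>+w. \<integral>\<^sup>+u. \<integral>\<^sup>+v. f w u * f w v \<partial>laplace e \<partial>laplace e \<partial>P)"
    by (simp add: V nn_integral_cmult nn_integral_multc)
  also have "\<dots> = (\<integral>\<^sup>+u. \<integral>\<^sup>+w. \<integral>\<^sup>+v. f w u * f w v \<partial>laplace e \<partial>P \<partial>laplace e)"
    by (rule PL.Fubini'[where f = "\<lambda>w u. \<integral>\<^sup>+v. f w u * f w v \<partial>laplace e", symmetric]) measurable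
  also have "\<dots> = (\<integral>\<^sup>+u. \<integral>\<^sup>+v. \<integral>\<^sup>+w. f w u * f w v \<partial>P \<partial>laplace e \<partial>laplace e)"
    by (intro nn_integral_cong, rule PL.Fubini'[where f = "\<lambda>w v. f w u * f w v" for u, symmetric]) measurable
  also have "\<dots> \<le> (\<integral>\<^sup>+u. \<integral>\<^sup>+v. \<phi> u * \<phi> v + 2 * \<rho> u v * \<phi> u + 2 * \<rho> u v * \<phi> v \<partial>laplace e \<partial>laplace e)"
    by (intro nn_integral_mono f2)
  also have "\<dots> = (\<integral>\<^sup>+u. \<integral>\<^sup>+v. \<phi> u * \<phi> v \<partial>laplace e \<partial>laplace e)
      + (\<integral>\<^sup>+u. \<integral>\<^sup>+v. 2 * \<rho> u v * \<phi> u \<partial>laplace e \<partial>laplace e)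
      + (\<integral>\<^sup>+u. \<integral>\<^sup>+v. 2 * \<rho> u v * \<phi> v \<partial>laplace e \<partial>laplace e)"
    by (simp add: nn_integral_add)
  also have "\<dots> \<le> ?\<Phi> * ?\<Phi> + 2 * \<delta> * ?\<Phi> + 2 * \<delta> * ?\<Phi>"
    unfolding i1 by (intro add_mono order_refl i2 i3)
  also have "\<dots> = ?\<Phi> * ?\<Phi> + (2 * \<delta> + 2 * \<delta>) * ?\<Phi>"
    by (simp add: distrib_right add.assoc)
  also have "2 * \<delta> + 2 * \<delta> = ennreal (8 * e / (1 - H))"
  proof -
    have "2 * \<delta> + 2 * \<delta> = ennreal 4 * \<delta>" by (simp add: distrib_right[symmetric])
    also have "\<dots> = ennreal (8 * e / (1 - H))"
      unfolding \<delta>_def by (subst ennreal_mult'[symmetric]) auto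
    finally show ?thesis .
  qed
  finally show "(\<integral>\<^sup>+w. V w * V w \<partial>P) \<le> (1 + log_energy H e y) * (1 + log_energy H e y)
        + ennreal (8 * e / (1 - H)) * (1 + log_energy H e y)"
    unfolding \<phi>_int .
qed

text \<open>
  The variances are \<open>O(e k)\<close>, hence summable, and the expectations converge to \<open>1 + a\<close>.
\<close>

lemma AE_shifted_energy_limit:
  assumes y: "y \<in> borel_measurable borel"
    and e: "\<And>k. e k > 0" "\<And>k. e k \<le> (1 / 2) ^ k"
    and fin: "\<And>k. log_energy H (e k) y \<noteq> \<top>" "a \<ge> 0"
    and lim: "(\<lambda>k. log_energy H (e k) y) \<longlonglongrightarrow> ennreal a"
  shows "AE w in P. (\<lambda>k. log_energy H (e k) (\<lambda>t. path_at w t + y t)) \<longlonglongrightarrow> ennreal (1 + a)"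
proof -
  define G where "G k = enn2real (log_energy H (e k) y)" for k
  have G: "log_energy H (e k) y = ennreal (G k)" "G k \<ge> 0" for k
    using fin(1)[of k] by (auto simp: G_def less_top)
  define p where "p k = 1 + G k" for k
  have p: "p k \<ge> 1" "1 + log_energy H (e k) y = ennreal (p k)" for k
    using G by (auto simp: p_def ennreal_plus)
  have "G \<longlonglongrightarrow> a" using lim fin(2) unfolding G by (simp add: G(2))
  then have p_lim: "p \<longlonglongrightarrow> 1 + a" unfolding p_def by (intro tendsto_intros)
  then obtain B where B: "\<And>k. p k \<le> B"
    using convergent_imp_Bseq[of p] unfolding convergent_def Bseq_def by (metis abs_le_D1 real_norm_def)
  define V where "V k w = log_energy H (e k) (\<lambda>t. path_at w t + y t)" for k w
  note mom = shifted_energy_moments[OF y e(1), folded V_def]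
  have V_meas [measurable]: "V k \<in> borel_measurable P" for k by (rule mom(3))
  define d where "d k = 8 * e k / (1 - H) * p k" for k
  have d0: "d k \<ge> 0" for k unfolding d_def using e(1)[of k] H p(1)[of k] by simp
  have dev: "(\<integral>\<^sup>+w. ennreal ((enn2real (V k w) - p k)\<^sup>2) \<partial>P) \<le> ennreal (d k)" for k
  proof (rule P.second_moment_about_mean[OF V_meas])
    show "(\<integral>\<^sup>+w. V k w \<partial>P) = ennreal (p k)" unfolding mom(1) by (rule p(2))
    have "(\<integral>\<^sup>+w. V k w * V k w \<partial>P) \<le> ennreal (p k) * ennreal (p k) + ennreal (8 * e k / (1 - H)) * ennreal (p k)"
      using mom(2)[of k] unfolding p(2) .
    also have "\<dots> = ennreal (p k * p k + d k)"
      unfolding d_def using e(1)[of k] H p(1)[of k]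
      by (simp add: ennreal_mult'[symmetric] ennreal_plus[symmetric] del: ennreal_plus)
    finally show "(\<integral>\<^sup>+w. V k w * V k w \<partial>P) \<le> ennreal (p k * p k + d k)" .
  qed (use p(1)[of k] d0 in auto)
  have "summable d"
  proof (rule summable_comparison_test')
    show "summable (\<lambda>k. 8 / (1 - H) * B * (1 / 2) ^ k)"
      by (intro summable_mult summable_geometric) simp
    fix k :: nat
    have "e k * p k \<le> (1 / 2) ^ k * B"
      using e[of k] B[of k] p(1)[of k] by (intro mult_mono) auto
    then have "8 / (1 - H) * (e k * p k) \<le> 8 / (1 - H) * ((1 / 2) ^ k * B)"
      using H by (intro mult_left_mono) auto
    then show "norm (d k) \<le> 8 / (1 - H) * B * (1 / 2) ^ k"
      using d0[of k] unfolding real_norm_def by (simp add: abs_of_nonneg[OF d0]) (simp add: d_def mult_ac)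
  qed
  then have "AE w in P. (\<lambda>k. (enn2real (V k w) - p k)\<^sup>2) \<longlonglongrightarrow> 0"
    by (intro AE_tendsto_zero_if_summable_integrals[where b = d] dev d0) auto
  moreover have "AE w in P. V k w \<noteq> \<top>" for k
    using nn_integral_PInf_AE[OF V_meas[of k]] mom(1)[of k] p(2)[of k] by simp
  then have "AE w in P. \<forall>k. V k w \<noteq> \<top>" by (simp add: AE_all_countable)
  ultimately have "AE w in P. (\<lambda>k. V k w) \<longlonglongrightarrow> ennreal (1 + a)"
  proof eventually_elim
    case (elim w)
    from tendsto_real_sqrt[OF elim(1)] have "(\<lambda>k. enn2real (V k w) - p k) \<longlonglongrightarrow> 0"
      by (simp add: tendsto_rabs_zero_iff)
    from tendsto_add[OF this p_lim] have "(\<lambda>k. enn2real (V k w)) \<longlonglongrightarrow> 1 + a" by simp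
    then have "(\<lambda>k. ennreal (enn2real (V k w))) \<longlonglongrightarrow> ennreal (1 + a)" by (rule tendsto_ennrealI)
    then show ?case using elim(2) by (simp add: less_top)
  qed
  then show ?thesis unfolding V_def .
qed

end

section \<open>Rescaling the path by an estimate of the random time scale\<close>

lemma borel_measurable_log_energy [measurable]:
  assumes "e > 0"
  shows "(\<lambda>x. log_energy H e (path_at x)) \<in> borel_measurable borel"
proof -
  interpret prob_space "laplace e" by (rule prob_space_laplace[OF assms])
  show ?thesis unfolding log_energy_def by measurable
qed

lemma Y_law_properties:
  assumes "is_M_density \<beta> M"
  shows "prob_space (Y_law M)" "AE \<tau> in Y_law M. \<tau> > 0"
    "sets (Y_law M) = sets (restrict_space borel {0..})"
proof -
  have sets_eq: "sets (restrict_space lborel {0..}) = sets (restrict_space borel {0::real..})"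
    by (rule sets_restrict_space_cong) simp
  have M [measurable]: "M \<in> borel_measurable (restrict_space lborel {0..})"
    using assms measurable_cong_sets[OF sets_eq refl, of borel] unfolding is_M_density_def by blast
  have nonneg: "\<And>\<tau>. \<tau> \<ge> 0 \<Longrightarrow> M \<tau> \<ge> 0"
    and hb: "has_bochner_integral (restrict_space lborel {0..}) M (mittag_leffler \<beta> 0)"
    using assms unfolding is_M_density_def by (auto dest: spec[of _ "0::real"])
  have "mittag_leffler \<beta> 0 = (\<Sum>n\<in>{0}. (0::real) ^ n / Gamma (\<beta> * real n + 1))"
    unfolding mittag_leffler_def by (rule suminf_finite) auto
  then have at_zero: "mittag_leffler \<beta> 0 = 1" by simp
  show "prob_space (Y_law M)"
  proof
    let ?N = "restrict_space lborel {0::real..}"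
    have "emeasure (Y_law M) (space (Y_law M)) = (\<integral>\<^sup>+\<tau>. ennreal (M \<tau>) * indicator (space ?N) \<tau> \<partial>?N)"
      unfolding Y_law_def space_density by (rule emeasure_density) measurable
    also have "\<dots> = (\<integral>\<^sup>+\<tau>. ennreal (M \<tau>) \<partial>?N)"
      by (rule nn_integral_cong) simp
    also have "\<dots> = ennreal (\<integral>\<tau>. M \<tau> \<partial>?N)"
    proof (rule nn_integral_eq_integral)
      show "integrable ?N M" using hb by (simp add: has_bochner_integral_iff)
      show "AE \<tau> in ?N. 0 \<le> M \<tau>" by (rule AE_I2) (simp add: space_restrict_space nonneg)
    qed
    also have "(\<integral>\<tau>. M \<tau> \<partial>?N) = 1" using hb by (simp add: has_bochner_integral_iff at_zero)
    finally show "emeasure (Y_law M) (space (Y_law M)) = 1" by simp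
  qed
  have "AE \<tau> in restrict_space lborel {0..}. \<tau> \<noteq> (0::real)"
    using AE_lborel_singleton[of "0::real"] by (subst AE_restrict_space_iff) auto
  moreover have "AE \<tau> in restrict_space lborel {0..}. \<tau> \<ge> (0::real)"
    by (rule AE_I2) (simp add: space_restrict_space)
  ultimately have "AE \<tau> in restrict_space lborel {0..}. \<tau> > (0::real)" by eventually_elim simp
  then show "AE \<tau> in Y_law M. \<tau> > 0"
    unfolding Y_law_def by (subst AE_density) auto
  show "sets (Y_law M) = sets (restrict_space borel {0..})"
    unfolding Y_law_def by (simp add: sets_eq)
qed

context fbm_paths
begin

text \<open>
  The event \<open>A\<close> has to be found for all time scales \<open>c\<close> at once, since the scale is random; then
  Fubini turns the hypotheses into statements about the two laws.
\<close>

lemma no_separating_event: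
  assumes M: "is_M_density \<beta> M"
    and eq: "equivalent_measures (ggbm_law H P (Y_law M)) (shifted_ggbm_law H h P (Y_law M))"
    and A: "A \<in> sets borel"
    and unshifted: "AE w in P. \<forall>c>0. \<forall>x. (\<forall>t. path_at x t = path_at w (t * c)) \<longrightarrow> x \<notin> A"
    and shifted: "AE w in P. \<forall>c>0. \<forall>x. (\<forall>t. path_at x t = path_at w (t * c) + path_at h (t * c)) \<longrightarrow> x \<in> A"
  shows False
proof -
  interpret Y: prob_space "Y_law M" by (rule Y_law_properties(1)[OF M])
  interpret PY: pair_prob_space P "Y_law M" ..
  have [measurable]: "snd \<in> borel_measurable (P \<Otimes>\<^sub>M Y_law M)"
  proof -
    have "snd \<in> P \<Otimes>\<^sub>M Y_law M \<rightarrow>\<^sub>M restrict_space borel {0..}"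
      using measurable_snd[of P "Y_law M"] by (simp cong: measurable_cong_sets add: Y_law_properties(3)[OF M])
    then show ?thesis using measurable_restrict_space2_iff by blast
  qed
  have [measurable]: "fst \<in> P \<Otimes>\<^sub>M Y_law M \<rightarrow>\<^sub>M (borel :: wpath measure)"
    using measurable_fst[of P "Y_law M"] by (simp cong: measurable_cong_sets)
  have G [measurable]: "(\<lambda>(w, \<tau>). ggbm_path H w \<tau>) \<in> borel_measurable (P \<Otimes>\<^sub>M Y_law M)"
    by (rule measurable_into_wpath) (simp add: case_prod_beta ggbm_path.rep_eq)
  have S [measurable]: "(\<lambda>(w, \<tau>). shifted_ggbm_path H h w \<tau>) \<in> borel_measurable (P \<Otimes>\<^sub>M Y_law M)"
  proof (rule measurable_into_wpath)
    fix t
    have "(\<lambda>p. path_at (fst p) (t * snd p powr (1 / (2 * H))) + path_at h (t * snd p powr (1 / (2 * H))))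
        \<in> borel_measurable (P \<Otimes>\<^sub>M Y_law M)" by measurable
    then show "(\<lambda>\<omega>. path_at (case \<omega> of (w, \<tau>) \<Rightarrow> shifted_ggbm_path H h w \<tau>) t) \<in> borel_measurable (P \<Otimes>\<^sub>M Y_law M)"
      by (simp add: case_prod_beta shifted_ggbm_path.rep_eq)
  qed
  have "AE p in P \<Otimes>\<^sub>M Y_law M. snd p > 0"
  proof -
    interpret YP: pair_prob_space "Y_law M" P ..
    have "AE q in Y_law M \<Otimes>\<^sub>M P. fst q > 0"
      by (rule AE_distrD[OF measurable_fst, where P = "\<lambda>\<tau>. \<tau> > 0"], subst P.distr_pair_fst)
        (rule Y_law_properties(2)[OF M])
    then have "AE q in distr (P \<Otimes>\<^sub>M Y_law M) (Y_law M \<Otimes>\<^sub>M P) (\<lambda>(x, y). (y, x)). fst q > 0"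
      by (subst YP.distr_pair_swap[symmetric])
    from AE_distrD[OF measurable_pair_swap' this] show ?thesis by (simp add: case_prod_beta)
  qed
  have fst_AE: "AE p in P \<Otimes>\<^sub>M Y_law M. Q (fst p)" if "AE w in P. Q w" for Q
    by (rule AE_distrD[OF measurable_fst, where P = Q], subst Y.distr_pair_fst) (rule that)
  have "AE p in P \<Otimes>\<^sub>M Y_law M. (case p of (w, \<tau>) \<Rightarrow> ggbm_path H w \<tau>) \<notin> A"
    using fst_AE[OF unshifted] \<open>AE p in P \<Otimes>\<^sub>M Y_law M. snd p > 0\<close>
  proof eventually_elim
    case (elim p)
    obtain w \<tau> where p: "p = (w, \<tau>)" by (cases p)
    with elim show ?case
      using elim(1)[rule_format, of "\<tau> powr (1 / (2 * H))" "ggbm_path H w \<tau>"]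
      by (simp add: ggbm_path.rep_eq)
  qed
  then have "AE x in ggbm_law H P (Y_law M). x \<notin> A"
    unfolding ggbm_law_def using A by (subst AE_distr_iff[OF G]) auto
  then have "A \<in> null_sets (ggbm_law H P (Y_law M))"
    using A by (intro AE_iff_null_sets[THEN iffD2]) (auto simp: ggbm_law_def)
  then have "A \<in> null_sets (shifted_ggbm_law H h P (Y_law M))"
    using eq unfolding equivalent_measures_def absolutely_continuous_def by blast
  then have "AE x in shifted_ggbm_law H h P (Y_law M). x \<notin> A" by (rule AE_not_in)
  then have "AE p in P \<Otimes>\<^sub>M Y_law M. (case p of (w, \<tau>) \<Rightarrow> shifted_ggbm_path H h w \<tau>) \<notin> A"
    unfolding shifted_ggbm_law_def by (rule AE_distrD[OF S])
  moreover have "AE p in P \<Otimes>\<^sub>M Y_law M. (case p of (w, \<tau>) \<Rightarrow> shifted_ggbm_path H h w \<tau>) \<in> A"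
    using fst_AE[OF shifted] \<open>AE p in P \<Otimes>\<^sub>M Y_law M. snd p > 0\<close>
  proof eventually_elim
    case (elim p)
    obtain w \<tau> where p: "p = (w, \<tau>)" by (cases p)
    with elim show ?case
      using elim(1)[rule_format, of "\<tau> powr (1 / (2 * H))" "shifted_ggbm_path H h w \<tau>"]
      by (simp add: shifted_ggbm_path.rep_eq)
  qed
  ultimately have "AE p in P \<Otimes>\<^sub>M Y_law M. False" by eventually_elim simp
  then show False using PY.AE_False by simp
qed

lemma AE_energy_limit:
  assumes "\<And>k. e k > 0" "\<And>k. e k \<le> (1 / 2) ^ k"
  shows "AE w in P. (\<lambda>k. log_energy H (e k) (path_at w)) \<longlonglongrightarrow> 1"
  using AE_shifted_energy_limit[of "\<lambda>_. 0" e 0] assms by (simp add: log_energy_def)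

text \<open>
  No variance bound is needed here: the energy of \<open>y = (w + y) - w\<close> is at most twice the sum of the
  energies of \<open>w + y\<close> and of \<open>w\<close>, and the latter stays bounded.
\<close>

lemma AE_shifted_energy_limit_top:
  assumes y [measurable]: "y \<in> borel_measurable borel"
    and e: "\<And>k. e k > 0" "\<And>k. e k \<le> (1 / 2) ^ k"
    and lim: "(\<lambda>k. log_energy H (e k) y) \<longlonglongrightarrow> \<top>"
  shows "AE w in P. (\<lambda>k. log_energy H (e k) (\<lambda>t. path_at w t + y t)) \<longlonglongrightarrow> \<top>"
  using AE_energy_limit[OF e]
proof eventually_elim
  case (elim w)
  have [measurable]: "path_at w \<in> borel_measurable borel"
    by (rule borel_measurable_continuous_onI[OF continuous_path_at])
  have ineq: "log_energy H (e k) y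
      \<le> 2 * log_energy H (e k) (\<lambda>t. path_at w t + y t) + 2 * log_energy H (e k) (path_at w)" for k
  proof -
    have *: "b\<^sup>2 \<le> 2 * (a + b)\<^sup>2 + 2 * a\<^sup>2" for a b :: real
    proof -
      have "0 \<le> (b + 2 * a)\<^sup>2" by simp
      then show ?thesis by (simp add: power2_eq_square algebra_simps)
    qed
    have "log_energy H (e k) y \<le> (\<integral>\<^sup>+u. 2 * ennreal ((exp (- (H * u)) * (path_at w (exp u) + y (exp u)))\<^sup>2)
        + 2 * ennreal ((exp (- (H * u)) * path_at w (exp u))\<^sup>2) \<partial>laplace (e k))"
      unfolding log_energy_def
    proof (rule nn_integral_mono)
      fix u
      define a where "a = exp (- (H * u)) * path_at w (exp u)"
      define b where "b = exp (- (H * u)) * y (exp u)"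
      have "ennreal (b\<^sup>2) \<le> ennreal (2 * (a + b)\<^sup>2 + 2 * a\<^sup>2)" by (rule ennreal_leI[OF *])
      also have "\<dots> = 2 * ennreal ((a + b)\<^sup>2) + 2 * ennreal (a\<^sup>2)"
        by (simp add: ennreal_plus ennreal_mult')
      finally show "ennreal ((exp (- (H * u)) * y (exp u))\<^sup>2)
          \<le> 2 * ennreal ((exp (- (H * u)) * (path_at w (exp u) + y (exp u)))\<^sup>2)
            + 2 * ennreal ((exp (- (H * u)) * path_at w (exp u))\<^sup>2)"
        by (simp add: a_def b_def distrib_left)
    qed
    also have "\<dots> = 2 * log_energy H (e k) (\<lambda>t. path_at w t + y t) + 2 * log_energy H (e k) (path_at w)"
      unfolding log_energy_def by (simp add: nn_integral_add nn_integral_cmult)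
    finally show ?thesis .
  qed
  show ?case
    unfolding tendsto_top_iff_ennreal
  proof (intro allI impI)
    fix l :: real assume l: "0 \<le> l"
    have "0 \<le> 2 * l + 4" using l by simp
    then have "eventually (\<lambda>k. ennreal (2 * l + 4) < log_energy H (e k) y) sequentially"
      by (rule lim[unfolded tendsto_top_iff_ennreal, rule_format])
    moreover have "eventually (\<lambda>k. log_energy H (e k) (path_at w) < 2) sequentially"
      using elim by (rule order_tendstoD) simp
    ultimately show "eventually (\<lambda>k. ennreal l < log_energy H (e k) (\<lambda>t. path_at w t + y t)) sequentially"
    proof eventually_elim
      case (elim k)
      show ?case
      proof (rule ccontr)
        assume "\<not> ?thesis"
        then have "log_energy H (e k) (\<lambda>t. path_at w t + y t) \<le> ennreal l" by simp
        then have "log_energy H (e k) y \<le> 2 * ennreal l + 2 * 2"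
          using elim(2) by (intro order_trans[OF ineq] add_mono mult_left_mono) auto
        also have "\<dots> = ennreal (2 * l + 4)" using l by (simp add: ennreal_plus ennreal_mult')
        finally show False using elim(1) by simp
      qed
    qed
  qed
qed

text \<open>
  The kernel norm is the \<open>L\<^sup>2\<close> norm of the corresponding combination of evaluations, and
  self-similarity accounts for the dilation of the path.
\<close>

lemma fin_eval_second_moment:
  assumes c: "Poly_Mapping.keys c \<subseteq> {0..}" and b: "b > 0"
  shows "has_bochner_integral P (\<lambda>w. (fin_eval (\<lambda>t. path_at w (t * b)) c)\<^sup>2)
           (b powr (2 * H) * kernel_inner (fbm_cov H) c c)"
proof -
  let ?F = "Poly_Mapping.keys c" and ?a = "Poly_Mapping.lookup c"
  have "has_bochner_integral P (\<lambda>w. \<Sum>t\<in>?F. \<Sum>s\<in>?F. (?a t * ?a s) * (path_at w (t * b) * path_at w (s * b)))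
      (\<Sum>t\<in>?F. \<Sum>s\<in>?F. (?a t * ?a s) * (b powr (2 * H) * fbm_cov H t s))"
  proof (intro has_bochner_integral_sum has_bochner_integral_mult_right)
    fix t s assume "t \<in> ?F" "s \<in> ?F"
    then have ts: "t \<ge> 0" "s \<ge> 0" using c by auto
    then have tsb: "t * b \<in> {0..}" "s * b \<in> {0..}" using b by auto
    have "P.expectation (\<lambda>w. path_at w (t * b) * path_at w (s * b)) = fbm_cov H (t * b) (s * b)"
      using gaussian tsb unfolding centered_gaussian_process_def by blast
    also have "\<dots> = b powr (2 * H) * fbm_cov H t s"
      using fbm_cov_scale[of b t s H] b ts by (simp add: mult.commute)
    finally show "has_bochner_integral P (\<lambda>w. path_at w (t * b) * path_at w (s * b)) (b powr (2 * H) * fbm_cov H t s)"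
      using P.gaussian_process_integrable[OF gaussian tsb] by (simp add: has_bochner_integral_iff)
  qed
  moreover have "(\<Sum>t\<in>?F. \<Sum>s\<in>?F. (?a t * ?a s) * (path_at w (t * b) * path_at w (s * b)))
      = (fin_eval (\<lambda>t. path_at w (t * b)) c)\<^sup>2" for w
    by (simp add: fin_eval_def power2_eq_square sum_product mult_ac)
  moreover have "(\<Sum>t\<in>?F. \<Sum>s\<in>?F. (?a t * ?a s) * (b powr (2 * H) * fbm_cov H t s))
      = b powr (2 * H) * kernel_inner (fbm_cov H) c c"
    by (simp add: kernel_inner_def sum_distrib_left mult_ac)
  ultimately show ?thesis by simp
qed

lemma kernel_inner_fbm_nonneg:
  assumes "Poly_Mapping.keys c \<subseteq> {0..}"
  shows "kernel_inner (fbm_cov H) c c \<ge> 0"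
proof -
  have "0 \<le> P.expectation (\<lambda>w. (fin_eval (\<lambda>t. path_at w (t * 1)) c)\<^sup>2)"
    by (rule Bochner_Integration.integral_nonneg) simp
  also have "\<dots> = kernel_inner (fbm_cov H) c c"
    using has_bochner_integral_integral_eq[OF fin_eval_second_moment[OF assms, of 1]] by simp
  finally show ?thesis .
qed

lemma AE_normalized_functional_tendsto_zero:
  assumes c: "\<And>n. Poly_Mapping.keys (c n) \<subseteq> {0..}"
    and small: "\<And>n. 4 ^ n * kernel_inner (fbm_cov H) (c n) (c n) < (l n)\<^sup>2"
    and b: "b > 0"
  shows "AE w in P. (\<lambda>n. fin_eval (\<lambda>t. path_at w (t * b)) (c n) / l n) \<longlonglongrightarrow> 0"
proof -
  let ?X = "\<lambda>n w. (fin_eval (\<lambda>t. path_at w (t * b)) (c n) / l n)\<^sup>2"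
  have "(\<integral>\<^sup>+w. ennreal (?X n w) \<partial>P) \<le> ennreal (b powr (2 * H) * (1 / 4) ^ n)" for n
  proof -
    let ?q = "kernel_inner (fbm_cov H) (c n) (c n)"
    have q: "?q \<ge> 0" by (rule kernel_inner_fbm_nonneg[OF c])
    then have "0 \<le> 4 ^ n * ?q" by simp
    then have l: "0 < (l n)\<^sup>2" using small[of n] by (rule le_less_trans)
    have "has_bochner_integral P (?X n) (b powr (2 * H) * ?q / (l n)\<^sup>2)"
      unfolding power_divide
      by (intro has_bochner_integral_divide_zero fin_eval_second_moment c b)
    then have "(\<integral>\<^sup>+w. ennreal (?X n w) \<partial>P) = ennreal (b powr (2 * H) * ?q / (l n)\<^sup>2)"
      by (subst nn_integral_eq_integral) (auto simp: has_bochner_integral_iff)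
    also have "\<dots> \<le> ennreal (b powr (2 * H) * (1 / 4) ^ n)"
    proof (rule ennreal_leI)
      have "?q / (l n)\<^sup>2 \<le> (1 / 4) ^ n"
        using small[of n] l by (simp add: field_simps)
      then have "b powr (2 * H) * (?q / (l n)\<^sup>2) \<le> b powr (2 * H) * (1 / 4) ^ n"
        by (intro mult_left_mono) auto
      then show "b powr (2 * H) * ?q / (l n)\<^sup>2 \<le> b powr (2 * H) * (1 / 4) ^ n" by simp
    qed
    finally show ?thesis .
  qed
  moreover have "summable (\<lambda>n. b powr (2 * H) * (1 / 4) ^ n)"
    by (intro summable_mult summable_geometric) simp
  moreover have "?X n \<in> borel_measurable P" for n
    unfolding fin_eval_def by measurable
  ultimately have "AE w in P. (\<lambda>n. ?X n w) \<longlonglongrightarrow> 0"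
    by (intro AE_tendsto_zero_if_summable_integrals[where b = "\<lambda>n. b powr (2 * H) * (1 / 4) ^ n"]) auto
  then show ?thesis
  proof eventually_elim
    case (elim w)
    from tendsto_real_sqrt[OF elim] show ?case
      by (simp add: tendsto_rabs_zero_iff del: abs_divide)
  qed
qed

end

lemma fin_eval_add_fun: "fin_eval (\<lambda>t. f t + g t) c = fin_eval f c + fin_eval g c"
  by (simp add: fin_eval_def distrib_left sum.distrib)

text \<open>
  Suppose \<open>h\<close> lies outside the Cameron--Martin space. The functional \<open>c \<mapsto> fin_eval (path_at h) c\<close> is
  then unbounded for the kernel norm, which yields combinations \<open>c n\<close> whose values \<open>l n\<close> at \<open>h\<close>
  dominate the standard deviations of their values at \<open>w\<close>. The separating event says that the energy
  diverges, if the energy of \<open>h\<close> does. Otherwise it says that the values of the combinations at the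
  path, rescaled by the estimate of the time scale and normalized by \<open>l n\<close>, do not tend to 0.
\<close>

lemma (in fbm_paths) shift_in_cameron_martin_if_equivalent:
  assumes M: "is_M_density \<beta> M"
    and eq: "equivalent_measures (ggbm_law H P (Y_law M)) (shifted_ggbm_law H h P (Y_law M))"
  shows "path_at h \<in> cameron_martin H"
proof (rule ccontr)
  assume notin: "path_at h \<notin> cameron_martin H"
  have "\<exists>c. Poly_Mapping.keys c \<subseteq> {0..} \<and>
      4 ^ n * kernel_inner (fbm_cov H) c c < (fin_eval (path_at h) c)\<^sup>2" for n
  proof (rule ccontr)
    assume "\<not> ?thesis"
    then have "(fin_eval (path_at h) c)\<^sup>2 \<le> 4 ^ n * kernel_inner (fbm_cov H) c c"
      if "Poly_Mapping.keys c \<subseteq> {0..}" for c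
      using that not_le by blast
    then have "path_at h \<in> rkhs {0..} (fbm_cov H)"
      by (intro in_rkhs_if_bounded_functional[where C = "4 ^ n"])
        (auto simp: path_at_nonpos intro: fbm_cov_commute)
    with notin show False unfolding cameron_martin_def by blast
  qed
  then obtain c where c: "\<And>n. Poly_Mapping.keys (c n) \<subseteq> {0..}"
    and small: "\<And>n. 4 ^ n * kernel_inner (fbm_cov H) (c n) (c n) < (fin_eval (path_at h) (c n))\<^sup>2"
    by metis
  define l where "l n = fin_eval (path_at h) (c n)" for n
  note small = small[folded l_def]
  have l: "l n \<noteq> 0" for n
  proof -
    have "0 \<le> 4 ^ n * kernel_inner (fbm_cov H) (c n) (c n)"
      using kernel_inner_fbm_nonneg[OF c[of n]] by simp
    then have "0 < (l n)\<^sup>2" using small[of n] by (rule le_less_trans)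
    then show ?thesis by auto
  qed
  have path_meas [measurable]: "path_at w \<in> borel_measurable borel" for w
    by (rule borel_measurable_continuous_onI[OF continuous_path_at])
  define V where "V e x = liminf (\<lambda>k. log_energy H (e k) (path_at x))" for e :: "nat \<Rightarrow> real" and x
  have V_meas: "V e \<in> borel_measurable borel" if "\<And>k. e k > 0" for e
    unfolding V_def by (intro borel_measurable_liminf borel_measurable_log_energy that)
  have V_limit: "V e x = ennreal (s powr (2 * H)) * L"
    if e: "\<And>k. e k > 0" "\<And>k. e k \<le> (1 / 2) ^ k" and s: "s > 0"
      and y [measurable]: "y \<in> borel_measurable borel" and x: "\<forall>t. path_at x t = y (t * s)"
      and lim: "(\<lambda>k. log_energy H (e k) y) \<longlonglongrightarrow> L" for e x y s L
  proof -
    have zero: "(\<lambda>k. (1 / 2 :: real) ^ k) \<longlonglongrightarrow> 0" by (rule LIMSEQ_power_zero) simp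
    have "e \<longlonglongrightarrow> 0"
      by (rule tendsto_sandwich[OF _ _ tendsto_const zero]) (simp_all add: e(2) less_imp_le[OF e(1)])
    from log_energy_dilation_limit[OF y s e(1) this lim]
    have "(\<lambda>k. log_energy H (e k) (path_at x)) \<longlonglongrightarrow> ennreal (s powr (2 * H)) * L"
      using x by presburger
    then show ?thesis unfolding V_def by (intro lim_imp_Liminf) auto
  qed
  \<comment> \<open>The energies of \<open>h\<close> need not converge, but \<open>[0,\<infinity>]\<close> is compact.\<close>
  obtain L r where r: "strict_mono r"
    and L: "(\<lambda>k. log_energy H ((1 / 2) ^ r k) (path_at h)) \<longlonglongrightarrow> L"
    using compact_complete_linorder[of "\<lambda>n. log_energy H ((1 / 2) ^ n) (path_at h)"]
    unfolding comp_def by blast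
  show False
  proof (cases "L = \<top>")
    case True
    define e where "e k = (1 / 2 :: real) ^ r k" for k
    have e: "e k > 0" "e k \<le> (1 / 2) ^ k" for k
      unfolding e_def using seq_suble[OF r, of k] by (auto intro!: power_decreasing)
    define A where "A = V e -` {\<top>} \<inter> space borel"
    show False
    proof (rule no_separating_event[OF M eq])
      show "A \<in> sets borel"
        unfolding A_def by (rule measurable_sets[OF V_meas[OF e(1)]]) simp
      show "AE w in P. \<forall>s>0. \<forall>x. (\<forall>t. path_at x t = path_at w (t * s)) \<longrightarrow> x \<notin> A"
        using AE_energy_limit[OF e]
      proof (eventually_elim, intro allI impI)
        fix w s x assume lim: "(\<lambda>k. log_energy H (e k) (path_at w)) \<longlonglongrightarrow> 1" and s: "s > 0"
          and x: "\<forall>t. path_at x t = path_at w (t * s)"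
        show "x \<notin> A" using V_limit[OF e s path_meas x lim] by (simp add: A_def)
      qed
      show "AE w in P. \<forall>s>0. \<forall>x. (\<forall>t. path_at x t = path_at w (t * s) + path_at h (t * s)) \<longrightarrow> x \<in> A"
        using AE_shifted_energy_limit_top[OF path_meas e L[folded e_def, unfolded True]]
      proof (eventually_elim, intro allI impI)
        fix w s x assume lim: "(\<lambda>k. log_energy H (e k) (\<lambda>t. path_at w t + path_at h t)) \<longlonglongrightarrow> \<top>"
          and s: "s > 0" and x: "\<forall>t. path_at x t = path_at w (t * s) + path_at h (t * s)"
        have "V e x = ennreal (s powr (2 * H)) * \<top>"
          by (rule V_limit[OF e s _ x lim]) measurable
        also have "\<dots> = \<top>" using s by (simp add: ennreal_mult_top)
        finally show "x \<in> A" by (simp add: A_def)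
      qed
    qed
  next
    case False
    then obtain a where a: "L = ennreal a" "a \<ge> 0" by (cases L) auto
    have "eventually (\<lambda>k. log_energy H ((1 / 2) ^ r k) (path_at h) < \<top>) sequentially"
      using L by (rule order_tendstoD) (simp add: a less_top[symmetric])
    then obtain K where K: "\<And>k. k \<ge> K \<Longrightarrow> log_energy H ((1 / 2) ^ r k) (path_at h) < \<top>"
      unfolding eventually_sequentially by blast
    \<comment> \<open>Dropping the first terms makes all energies of \<open>h\<close> finite.\<close>
    define e where "e k = (1 / 2 :: real) ^ r (k + K)" for k
    have e: "e k > 0" "e k \<le> (1 / 2) ^ k" for k
      unfolding e_def using seq_suble[OF r, of "k + K"] by (auto intro!: power_decreasing)
    have fin: "log_energy H (e k) (path_at h) \<noteq> \<top>" for k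
      unfolding e_def using K[of "k + K"] by simp
    have lim_h: "(\<lambda>k. log_energy H (e k) (path_at h)) \<longlonglongrightarrow> ennreal a"
      unfolding e_def using LIMSEQ_ignore_initial_segment[OF L, of K] a by simp
    define b where "b = (1 + a) powr (1 / (2 * H))"
    have b: "b > 0" unfolding b_def using a by simp
    \<comment> \<open>The estimate of \<open>\<tau> powr (1 / (2 * H))\<close>: exact for the shifted path, too small by the constant factor \<open>b\<close> for the unshifted one.\<close>
    define d where "d x = (enn2real (V e x) / (1 + a)) powr (1 / (2 * H))" for x
    define S where "S n x = fin_eval (\<lambda>t. path_at x (t / d x)) (c n) / l n" for n x
    define A where "A = {x \<in> space borel. limsup (\<lambda>n. ennreal \<bar>S n x\<bar>) \<noteq> 0}"
    have [measurable]: "V e \<in> borel_measurable borel" by (rule V_meas[OF e(1)])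
    have [measurable]: "d \<in> borel_measurable borel" unfolding d_def by measurable
    have [measurable]: "S n \<in> borel_measurable borel" for n
      unfolding S_def fin_eval_def by measurable
    have root: "(s powr (2 * H)) powr (1 / (2 * H)) = s" if "s > 0" for s :: real
      using that H by (simp add: powr_powr)
    show False
    proof (rule no_separating_event[OF M eq])
      show "A \<in> sets borel" unfolding A_def by measurable
      have "AE w in P. (\<lambda>k. log_energy H (e k) (path_at w)) \<longlonglongrightarrow> 1 \<and>
          (\<lambda>n. fin_eval (\<lambda>t. path_at w (t * b)) (c n) / l n) \<longlonglongrightarrow> 0"
        using AE_energy_limit[OF e] AE_normalized_functional_tendsto_zero[OF c small b] by eventually_elim simp
      then show "AE w in P. \<forall>s>0. \<forall>x. (\<forall>t. path_at x t = path_at w (t * s)) \<longrightarrow> x \<notin> A"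
      proof (eventually_elim, intro allI impI)
        fix w s x
        assume lim: "(\<lambda>k. log_energy H (e k) (path_at w)) \<longlonglongrightarrow> 1 \<and>
          (\<lambda>n. fin_eval (\<lambda>t. path_at w (t * b)) (c n) / l n) \<longlonglongrightarrow> 0"
          and s: "s > 0" and x: "\<forall>t. path_at x t = path_at w (t * s)"
        have "V e x = ennreal (s powr (2 * H))"
          using V_limit[OF e s path_meas x conjunct1[OF lim]] by simp
        then have "d x = s / b"
          using a by (simp add: d_def b_def powr_divide root[OF s])
        then have "path_at x (t / d x) = path_at w (t * b)" for t
          using x s b by simp
        then have "S n x = fin_eval (\<lambda>t. path_at w (t * b)) (c n) / l n" for n
          unfolding S_def by simp
        then have "(\<lambda>n. S n x) \<longlonglongrightarrow> 0" using lim by simp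
        then have "(\<lambda>n. ennreal \<bar>S n x\<bar>) \<longlonglongrightarrow> ennreal \<bar>0\<bar>"
          by (intro tendsto_ennrealI tendsto_rabs)
        then have "limsup (\<lambda>n. ennreal \<bar>S n x\<bar>) = ennreal \<bar>0\<bar>"
          by (intro lim_imp_Limsup) auto
        then show "x \<notin> A" by (simp add: A_def)
      qed
      have "AE w in P. (\<lambda>k. log_energy H (e k) (\<lambda>t. path_at w t + path_at h t)) \<longlonglongrightarrow> ennreal (1 + a) \<and>
          (\<lambda>n. fin_eval (\<lambda>t. path_at w (t * 1)) (c n) / l n) \<longlonglongrightarrow> 0"
        using AE_shifted_energy_limit[OF path_meas e fin a(2) lim_h]
          AE_normalized_functional_tendsto_zero[OF c small zero_less_one] by eventually_elim simp
      then show "AE w in P. \<forall>s>0. \<forall>x. (\<forall>t. path_at x t = path_at w (t * s) + path_at h (t * s)) \<longrightarrow> x \<in> A"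
      proof (eventually_elim, intro allI impI)
        fix w s x
        assume lim: "(\<lambda>k. log_energy H (e k) (\<lambda>t. path_at w t + path_at h t)) \<longlonglongrightarrow> ennreal (1 + a) \<and>
          (\<lambda>n. fin_eval (\<lambda>t. path_at w (t * 1)) (c n) / l n) \<longlonglongrightarrow> 0"
          and s: "s > 0" and x: "\<forall>t. path_at x t = path_at w (t * s) + path_at h (t * s)"
        have "V e x = ennreal (s powr (2 * H)) * ennreal (1 + a)"
          by (rule V_limit[OF e s _ x conjunct1[OF lim]]) measurable
        also have "\<dots> = ennreal (s powr (2 * H) * (1 + a))" by (simp add: ennreal_mult')
        finally have "enn2real (V e x) = s powr (2 * H) * (1 + a)" using a(2) by simp
        then have "d x = s"
          using a(2) root[OF s] by (simp add: d_def)
        then have "path_at x (t / d x) = path_at w t + path_at h t" for t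
          using x s by simp
        then have "S n x = fin_eval (\<lambda>t. path_at w (t * 1)) (c n) / l n + 1" for n
          unfolding S_def using l[of n] by (simp add: fin_eval_add_fun l_def add_divide_distrib)
        then have "(\<lambda>n. S n x) \<longlonglongrightarrow> 0 + 1"
          using tendsto_add[OF conjunct2[OF lim] tendsto_const[of 1]] by simp
        then have "(\<lambda>n. ennreal \<bar>S n x\<bar>) \<longlonglongrightarrow> ennreal \<bar>0 + 1\<bar>"
          by (intro tendsto_ennrealI tendsto_rabs)
        then have "limsup (\<lambda>n. ennreal \<bar>S n x\<bar>) = ennreal \<bar>0 + 1\<bar>"
          by (intro lim_imp_Limsup) auto
        then show "x \<in> A" by (simp add: A_def)
      qed
    qed
  qed
qed

theorem theorem3p7:
  fixes \<beta> H :: real and h :: wpath and P :: "wpath measure" and M :: "real \<Rightarrow> real"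
  assumes "0 < \<beta>" and "\<beta> < 1" and "1 / 2 < H" and "H < 1"
    and "is_fbm_law H P"
    and "is_M_density \<beta> M"
    and "equivalent_measures (ggbm_law H P (Y_law M)) (shifted_ggbm_law H h P (Y_law M))"
  shows "path_at h \<in> cameron_martin H"
proof -
  interpret fbm_paths H P
    using assms(3-5) by unfold_locales
  show ?thesis
    using assms(6,7) by (rule shift_in_cameron_martin_if_equivalent)
qed

end
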